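(* Let $G$ be a finite group and let $p$ be a prime divisor of $|G|$. Then the simplicial set $X=R_p(G)/G$, whose geometric realization is $\mathcal R_p(G)/G$, admits a Morse matching with exactly one critical cell, namely the vertex $[P]$ corresponding to the conjugacy class of Sylow $p$-subgroups $P$ of $G$.
   Context: $\mathcal R_p(G)$ is the simplicial complex whose $n$-simplices are the chains $P_0<\cdots<P_n$ of nontrivial $p$-subgroups of $G$ such that $P_i\lhd P_n$ for $0\leq i\leq n$; $G$ acts on it by conjugation and $\mathcal R_p(G)/G$ is the orbit space. $R_p(G)$ is the simplicial set whose $n$-simplices are the tuples $(P_0,\ldots,P_n)$ of nontrivial $p$-subgroups of $G$ with $P_0\leq\cdots\leq P_n$ and $P_i\lhd P_n$ for all $0\leq i\leq n$. The face map $d_i$ omits the entry $P_i$, and the degeneracy map $\sigma_i$ repeats the entry $P_i$. The group $G$ acts on $R_p(G)$ by simplicial automorphisms via $g(P_0,\ldots,P_n)=(gP_0g^{-1},\ldots,gP_ng^{-1})$, and $R_p(G)/G$ is the quotient simplicial set. The orbit of $(P_0,\ldots,P_n)$ is written $[P_0,\ldots,P_n]$; it is nondegenerate if and only if $P_0<\cdots<P_n$. A Morse matching for a simplicial set $X$ consists of the following data: (1) a partition of the nondegenerate simplices (called cells) of $X$ into three types: critical, collapsible and redundant; (2) a bijection $c$ from the set of redundant cells to the set of collapsible cells such that, for each redundant $n$-cell $\tau$, one has $c(\tau)\in X_{n+1}$, together with a distinguished index $\iota(\tau)\in\{0,\ldots,n+1\}$ such that $\tau=d_{\iota(\tau)}(c(\tau))$.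 These data are required to satisfy the following condition: let $D$ be the directed graph whose vertices are the redundant and collapsible cells, and whose edges are $\tau\to c(\tau)$ for $\tau$ redundant, and $\sigma\to d_j(\sigma)$ for $\sigma$ collapsible and $j\neq\iota(c^{-1}(\sigma))$ (whenever $d_j(\sigma)$ is a vertex of $D$); then $D$ has no infinite directed path. *)

theory Defs
  imports
    "HOL-Algebra.Group_Action"
    "HOL-Computational_Algebra.Primes"
    "HOL-Homology.Simplices"
begin

section \<open>Simplicial sets\<close>

text \<open>
  The maps \<open>face X n i\<close> from \<open>X\<^sub>n\<close> to \<open>X\<^sub>n\<^sub>-\<^sub>1\<close> and \<open>degen X n i\<close> from \<open>X\<^sub>n\<close> to \<open>X\<^sub>n\<^sub>+\<^sub>1\<close> carry the
  dimension of their source explicitly, since the sets \<open>X\<^sub>n\<close> are not assumed to be disjoint.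
\<close>

record 'x sset =
  simplices :: "nat \<Rightarrow> 'x set"
  face :: "nat \<Rightarrow> nat \<Rightarrow> 'x \<Rightarrow> 'x"
  degen :: "nat \<Rightarrow> nat \<Rightarrow> 'x \<Rightarrow> 'x"

locale simplicial_set =
  fixes X :: "'x sset"
  assumes face_closed:
      "\<lbrakk>x \<in> simplices X (Suc n); i \<le> Suc n\<rbrakk> \<Longrightarrow> face X (Suc n) i x \<in> simplices X n"
    and degen_closed:
      "\<lbrakk>x \<in> simplices X n; i \<le> n\<rbrakk> \<Longrightarrow> degen X n i x \<in> simplices X (Suc n)"
    and face_face:
      "\<lbrakk>x \<in> simplices X (Suc (Suc n)); i < j; j \<le> Suc (Suc n)\<rbrakk> \<Longrightarrow>
        face X (Suc n) i (face X (Suc (Suc n)) j x) =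
        face X (Suc n) (j - 1) (face X (Suc (Suc n)) i x)"
    and face_degen_below:
      "\<lbrakk>x \<in> simplices X (Suc n); i < j; j \<le> Suc n\<rbrakk> \<Longrightarrow>
        face X (Suc (Suc n)) i (degen X (Suc n) j x) = degen X n (j - 1) (face X (Suc n) i x)"
    and face_degen_same:
      "\<lbrakk>x \<in> simplices X n; j \<le> n; i = j \<or> i = Suc j\<rbrakk> \<Longrightarrow>
        face X (Suc n) i (degen X n j x) = x"
    and face_degen_above:
      "\<lbrakk>x \<in> simplices X (Suc n); Suc j < i; i \<le> Suc (Suc n)\<rbrakk> \<Longrightarrow>
        face X (Suc (Suc n)) i (degen X (Suc n) j x) = degen X n j (face X (Suc n) (i - 1) x)"
    and degen_degen:
      "\<lbrakk>x \<in> simplices X n; i \<le> j; j \<le> n\<rbrakk> \<Longrightarrow>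
        degen X (Suc n) i (degen X n j x) = degen X (Suc n) (Suc j) (degen X n i x)"

definition nondegenerate :: "'x sset \<Rightarrow> nat \<Rightarrow> 'x \<Rightarrow> bool" where
  "nondegenerate X n x \<longleftrightarrow>
     x \<in> simplices X n \<and>
     \<not> (\<exists>m i y. n = Suc m \<and> i \<le> m \<and> y \<in> simplices X m \<and> x = degen X m i y)"

text \<open>Cells are recorded together with their dimension.\<close>

definition cells :: "'x sset \<Rightarrow> (nat \<times> 'x) set" where
  "cells X = {(n, x). nondegenerate X n x}"

text \<open>
  The orbits of a group acting by simplicial automorphisms; by equivariance, the image of an
  orbit under a face or degeneracy map is again an orbit.
\<close>

definition sset_quotient ::
  "('a, 'm) monoid_scheme \<Rightarrow> ('a \<Rightarrow> 'x \<Rightarrow> 'x) \<Rightarrow> 'x sset \<Rightarrow> 'x set sset" where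
  "sset_quotient G \<phi> X =
     \<lparr>simplices = (\<lambda>n. orbits G (simplices X n) \<phi>),
      face = (\<lambda>n i A. face X n i ` A),
      degen = (\<lambda>n i A. degen X n i ` A)\<rparr>"


section \<open>Morse matchings\<close>

text \<open>
  The edge relation of the directed graph \<open>D\<close>; its vertices are the redundant and the
  collapsible cells.
\<close>

definition matching_edges ::
  "'x sset \<Rightarrow> (nat \<times> 'x) set \<Rightarrow> (nat \<times> 'x) set \<Rightarrow> (nat \<times> 'x \<Rightarrow> nat \<times> 'x) \<Rightarrow>
   (nat \<times> 'x \<Rightarrow> nat) \<Rightarrow> ((nat \<times> 'x) \<times> (nat \<times> 'x)) set" where
  "matching_edges X collapsible redundant c \<iota> =
     {(\<tau>, c \<tau>) | \<tau>. \<tau> \<in> redundant} \<union>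
     {((Suc n, x), (n, face X (Suc n) j x)) | n x j.
        (Suc n, x) \<in> collapsible \<and> j \<le> Suc n \<and>
        j \<noteq> \<iota> (inv_into redundant c (Suc n, x)) \<and>
        (n, face X (Suc n) j x) \<in> redundant \<union> collapsible}"

locale morse_matching = simplicial_set X
  for X :: "'x sset" +
  fixes critical collapsible redundant :: "(nat \<times> 'x) set"
    and c :: "nat \<times> 'x \<Rightarrow> nat \<times> 'x"
    and \<iota> :: "nat \<times> 'x \<Rightarrow> nat"
  assumes cells_eq: "cells X = critical \<union> collapsible \<union> redundant"
    and disjoint: "critical \<inter> collapsible = {}" "critical \<inter> redundant = {}"
      "collapsible \<inter> redundant = {}"
    and c_bij: "bij_betw c redundant collapsible"
    and c_dim: "(n, x) \<in> redundant \<Longrightarrow> fst (c (n, x)) = Suc n"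
    and index_le: "(n, x) \<in> redundant \<Longrightarrow> \<iota> (n, x) \<le> Suc n"
    and face_index:
      "(n, x) \<in> redundant \<Longrightarrow> x = face X (Suc n) (\<iota> (n, x)) (snd (c (n, x)))"
    and no_infinite_path:
      "\<not> (\<exists>v :: nat \<Rightarrow> nat \<times> 'x.
            \<forall>k. (v k, v (Suc k)) \<in> matching_edges X collapsible redundant c \<iota>)"


section \<open>Geometric realizations and orbit spaces\<close>

text \<open>The quotient topology on the image of \<open>q\<close>.\<close>

definition quotient_space :: "'s topology \<Rightarrow> ('s \<Rightarrow> 't) \<Rightarrow> 't topology" where
  "quotient_space T q =
     topology (\<lambda>U. U \<subseteq> q ` topspace T \<and> openin T {x \<in> topspace T. q x \<in> U})"

lemma openin_quotient_space:
  "openin (quotient_space T q) U \<longleftrightarrow>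
     U \<subseteq> q ` topspace T \<and> openin T {x \<in> topspace T. q x \<in> U}"
proof -
  have "istopology (\<lambda>U. U \<subseteq> q ` topspace T \<and> openin T {x \<in> topspace T. q x \<in> U})"
    unfolding istopology_def
  proof (intro conjI allI impI; (elim conjE)?)
    fix S S' assume "openin T {x \<in> topspace T. q x \<in> S}" "openin T {x \<in> topspace T. q x \<in> S'}"
    then have "openin T ({x \<in> topspace T. q x \<in> S} \<inter> {x \<in> topspace T. q x \<in> S'})"
      by (rule openin_Int)
    then show "openin T {x \<in> topspace T. q x \<in> S \<inter> S'}"
      by (rule back_subst[where P = "openin _"]) auto
  next
    fix K assume "\<forall>S\<in>K. S \<subseteq> q ` topspace T \<and> openin T {x \<in> topspace T. q x \<in> S}"
    then have "openin T (\<Union>S\<in>K. {x \<in> topspace T. q x \<in> S})"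
      by (intro openin_Union) auto
    then show "openin T {x \<in> topspace T. q x \<in> \<Union>K}"
      by (rule back_subst[where P = "openin _"]) auto
  qed auto
  then show ?thesis
    by (simp add: quotient_space_def)
qed

definition orbit_space ::
  "('a, 'm) monoid_scheme \<Rightarrow> ('a \<Rightarrow> 's \<Rightarrow> 's) \<Rightarrow> 's topology \<Rightarrow> 's set topology" where
  "orbit_space G \<phi> T = quotient_space T (orbit G \<phi>)"

text \<open>
  The affine map from the standard \<open>(n+1)\<close>-simplex to the standard \<open>n\<close>-simplex that identifies
  the vertices \<open>k\<close> and \<open>k+1\<close>. Its counterpart, the inclusion of the face opposite to the
  vertex \<open>k\<close>, is \<^const>\<open>simplical_face\<close>.
\<close>

definition simplicial_degen :: "nat \<Rightarrow> (nat \<Rightarrow> real) \<Rightarrow> nat \<Rightarrow> real" where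
  "simplicial_degen k t =
     (\<lambda>i. if i < k then t i else if i = k then t k + t (Suc k) else t (Suc i))"

definition pre_realization :: "'x sset \<Rightarrow> (nat \<times> 'x \<times> (nat \<Rightarrow> real)) topology" where
  "pre_realization X =
     sum_topology
       (\<lambda>n. prod_topology (discrete_topology (simplices X n))
              (subtopology (powertop_real UNIV) (standard_simplex n)))
       UNIV"

definition realization_rel ::
  "'x sset \<Rightarrow> ((nat \<times> 'x \<times> (nat \<Rightarrow> real)) \<times> (nat \<times> 'x \<times> (nat \<Rightarrow> real))) set" where
  "realization_rel X =
     {((n, face X (Suc n) i x, t), (Suc n, x, simplical_face i t)) | n i x t.
        x \<in> simplices X (Suc n) \<and> i \<le> Suc n \<and> t \<in> standard_simplex n} \<union>
     {((Suc n, degen X n i x, t), (n, x, simplicial_degen i t)) | n i x t.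
        x \<in> simplices X n \<and> i \<le> n \<and> t \<in> standard_simplex (Suc n)}"

definition sset_realization ::
  "'x sset \<Rightarrow> (nat \<times> 'x \<times> (nat \<Rightarrow> real)) set topology" where
  "sset_realization X =
     quotient_space (pre_realization X)
       (\<lambda>a. (realization_rel X \<union> (realization_rel X)\<inverse>)\<^sup>* `` {a})"

text \<open>
  An abstract simplicial complex is given by the set \<open>K\<close> of its simplices, each being the
  finite nonempty set of its vertices. Points of the realization are given by their barycentric
  coordinates, and the topology is the weak one.
\<close>

definition complex_points :: "'v set set \<Rightarrow> ('v \<Rightarrow> real) set" where
  "complex_points K =
     {\<alpha>. (\<forall>v. 0 \<le> \<alpha> v) \<and> {v. \<alpha> v \<noteq> 0} \<in> K \<and> (\<Sum>v | \<alpha> v \<noteq> 0. \<alpha> v) = 1}"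

definition closed_simplex :: "'v set set \<Rightarrow> 'v set \<Rightarrow> ('v \<Rightarrow> real) topology" where
  "closed_simplex K s =
     subtopology (powertop_real UNIV) {\<alpha> \<in> complex_points K. {v. \<alpha> v \<noteq> 0} \<subseteq> s}"

definition complex_realization :: "'v set set \<Rightarrow> ('v \<Rightarrow> real) topology" where
  "complex_realization K =
     topology (\<lambda>U. U \<subseteq> complex_points K \<and>
       (\<forall>s\<in>K. openin (closed_simplex K s) (U \<inter> topspace (closed_simplex K s))))"

lemma openin_complex_realization:
  "openin (complex_realization K) U \<longleftrightarrow> U \<subseteq> complex_points K \<and>
     (\<forall>s\<in>K. openin (closed_simplex K s) (U \<inter> topspace (closed_simplex K s)))"
proof -
  have "istopology (\<lambda>U. U \<subseteq> complex_points K \<and>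
       (\<forall>s\<in>K. openin (closed_simplex K s) (U \<inter> topspace (closed_simplex K s))))"
    unfolding istopology_def
  proof (intro conjI allI impI ballI; (elim conjE)?)
    fix S S' s
    assume "\<forall>s\<in>K. openin (closed_simplex K s) (S \<inter> topspace (closed_simplex K s))"
      "\<forall>s\<in>K. openin (closed_simplex K s) (S' \<inter> topspace (closed_simplex K s))" "s \<in> K"
    then have "openin (closed_simplex K s)
        ((S \<inter> topspace (closed_simplex K s)) \<inter> (S' \<inter> topspace (closed_simplex K s)))"
      using openin_Int by blast
    then show "openin (closed_simplex K s) (S \<inter> S' \<inter> topspace (closed_simplex K s))"
      by (rule back_subst[where P = "openin _"]) auto
  next
    fix \<U> s
    assume "\<forall>U\<in>\<U>. U \<subseteq> complex_points K \<and>
        (\<forall>s\<in>K. openin (closed_simplex K s) (U \<inter> topspace (closed_simplex K s)))" "s \<in> K"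
    then have "openin (closed_simplex K s) (\<Union>U\<in>\<U>. U \<inter> topspace (closed_simplex K s))"
      by (intro openin_Union) auto
    then show "openin (closed_simplex K s) (\<Union>\<U> \<inter> topspace (closed_simplex K s))"
      by (rule back_subst[where P = "openin _"]) auto
  qed auto
  then show ?thesis
    by (simp add: complex_realization_def)
qed

text \<open>The affine extension of a vertex map \<open>f\<close>.\<close>

definition affine_extension :: "('v \<Rightarrow> 'v) \<Rightarrow> ('v \<Rightarrow> real) \<Rightarrow> 'v \<Rightarrow> real" where
  "affine_extension f \<alpha> = (\<lambda>w. \<Sum>v | \<alpha> v \<noteq> 0 \<and> f v = w. \<alpha> v)"


section \<open>Complexes of \<open>p\<close>-subgroups\<close>

definition nontrivial_p_subgroup :: "('a, 'm) monoid_scheme \<Rightarrow> nat \<Rightarrow> 'a set \<Rightarrow> bool" where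
  "nontrivial_p_subgroup G p P \<longleftrightarrow>
     subgroup P G \<and> (\<exists>k. card P = p ^ k) \<and> P \<noteq> {\<one>\<^bsub>G\<^esub>}"

definition sylow_subgroup :: "('a, 'm) monoid_scheme \<Rightarrow> nat \<Rightarrow> 'a set \<Rightarrow> bool" where
  "sylow_subgroup G p P \<longleftrightarrow> subgroup P G \<and> card P = p ^ multiplicity p (order G)"

definition conj_subgroup :: "('a, 'm) monoid_scheme \<Rightarrow> 'a \<Rightarrow> 'a set \<Rightarrow> 'a set" where
  "conj_subgroup G g P = g <#\<^bsub>G\<^esub> (P #>\<^bsub>G\<^esub> inv\<^bsub>G\<^esub> g)"

text \<open>
  The simplicial set \<open>R\<^sub>p(G)\<close>, the tuple \<open>(P\<^sub>0, \<dots>, P\<^sub>n)\<close> being a list of length \<open>n + 1\<close>.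
\<close>

definition p_sset :: "('a, 'm) monoid_scheme \<Rightarrow> nat \<Rightarrow> 'a set list sset" where
  "p_sset G p =
     \<lparr>simplices = (\<lambda>n. {Ps. length Ps = Suc n \<and> sorted_wrt (\<subseteq>) Ps \<and>
        (\<forall>P \<in> set Ps. nontrivial_p_subgroup G p P \<and> P \<lhd> G\<lparr>carrier := last Ps\<rparr>)}),
      face = (\<lambda>n i Ps. take i Ps @ drop (Suc i) Ps),
      degen = (\<lambda>n i Ps. take (Suc i) Ps @ drop i Ps)\<rparr>"

definition conj_chain :: "('a, 'm) monoid_scheme \<Rightarrow> 'a \<Rightarrow> 'a set list \<Rightarrow> 'a set list" where
  "conj_chain G g = map (conj_subgroup G g)"

definition p_orbit_sset :: "('a, 'm) monoid_scheme \<Rightarrow> nat \<Rightarrow> 'a set list set sset" where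
  "p_orbit_sset G p = sset_quotient G (conj_chain G) (p_sset G p)"

text \<open>
  The simplicial complex \<open>\<R>\<^sub>p(G)\<close>; a strict chain is determined by the set of its members.
\<close>

definition p_complex :: "('a, 'm) monoid_scheme \<Rightarrow> nat \<Rightarrow> 'a set set set" where
  "p_complex G p =
     {set Ps | Ps. Ps \<noteq> [] \<and> sorted_wrt (\<subset>) Ps \<and>
        (\<forall>P \<in> set Ps. nontrivial_p_subgroup G p P \<and> P \<lhd> G\<lparr>carrier := last Ps\<rparr>)}"

definition p_complex_orbit_space ::
  "('a, 'm) monoid_scheme \<Rightarrow> nat \<Rightarrow> ('a set \<Rightarrow> real) set topology" where
  "p_complex_orbit_space G p =
     orbit_space G (\<lambda>g. affine_extension (conj_subgroup G g))
       (complex_realization (p_complex G p))"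

end

theory Submission
  imports Defs "HOL-Algebra.Sylow"
begin

text \<open>
  \<^emph>\<open>The homeomorphism.\<close> A chain \<open>(P\<^sub>0, \<dots>, P\<^sub>n)\<close> and a point \<open>t\<close> of the standard \<open>n\<close>-simplex
  determine the point \<open>t\<^sub>0 P\<^sub>0 + \<dots> + t\<^sub>n P\<^sub>n\<close> of the realization of \<open>\<R>\<^sub>p(G)\<close>. On orbits this
  gives a map \<open>orbit_point\<close> from the disjoint union of the spaces \<open>X\<^sub>n \<times> \<Delta>\<^sup>n\<close> onto
  \<open>\<R>\<^sub>p(G)/G\<close>. Deleting entries with coordinate zero and merging equal entries brings every
  argument into a form with a strict chain and nonzero coordinates without leaving its class
  under the face and degeneracy relations (\<open>realization_normal_form\<close>). In that form the chain is
  the support of the point, hence is determined by the orbit of the point up to conjugation. So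
  the fibres of \<open>orbit_point\<close> are exactly the points of the realization of \<open>X\<close>
  (\<open>orbit_point_eq_iff\<close>). Moreover \<open>orbit_point\<close> is a quotient map: on the closed
  simplex spanned by a strict chain, barycentric coordinates are a continuous inverse
  (\<open>quotient_map_orbit_point\<close>). Two quotient maps with the same source and the same fibres have
  homeomorphic targets.

  \<^emph>\<open>The matching.\<close> For a chain \<open>\<sigma> = (P\<^sub>0, \<dots>, P\<^sub>n)\<close> let \<open>N(\<sigma>)\<close> be the intersection of the
  normalizers of its members. Since all \<open>P\<^sub>i\<close> are normal in \<open>P\<^sub>n\<close>, the top \<open>P\<^sub>n\<close> is a normal
  \<open>p\<close>-subgroup of \<open>N(\<sigma>)\<close> and so lies in every Sylow \<open>p\<close>-subgroup \<open>Q\<close> of \<open>N(\<sigma>)\<close>; and \<open>Q\<close>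
  normalizes all \<open>P\<^sub>i\<close>, so \<open>(\<sigma>, Q)\<close> is again a simplex. Its orbit does not depend on \<open>Q\<close>,
  because Sylow subgroups of \<open>N(\<sigma>)\<close> are conjugate by elements that fix \<open>\<sigma>\<close>
  (\<open>extend_orbit\<close>). If \<open>P\<^sub>n\<close> is not itself Sylow in \<open>N(\<sigma>)\<close>, then \<open>[\<sigma>]\<close> is redundant and is
  matched with \<open>[\<sigma>, Q]\<close>.

  The remaining cells are those where \<open>P\<^sub>n\<close> is Sylow in \<open>N(\<sigma>)\<close>, which is the normalizer of \<open>P\<^sub>n\<close>
  in \<open>N(P\<^sub>0, \<dots>, P\<^sub>n\<^sub>-\<^sub>1)\<close>. A \<open>p\<close>-subgroup that is Sylow in its normalizer is Sylow, so this says
  that \<open>P\<^sub>n\<close> is Sylow in \<open>N(P\<^sub>0, \<dots>, P\<^sub>n\<^sub>-\<^sub>1)\<close> (\<open>saturated_snoc_iff\<close>). For \<open>n > 0\<close> the cell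
  is therefore the partner of \<open>[P\<^sub>0, \<dots>, P\<^sub>n\<^sub>-\<^sub>1]\<close>; for \<open>n = 0\<close> the subgroup \<open>P\<^sub>0\<close> is Sylow in \<open>G\<close>,
  and there is one such cell. The matching is acyclic because a step up makes the top of the chain
  larger, while the unmatched faces keep the top (\<open>matching_edge_decreases\<close>).
\<close>

section \<open>Orbits of group actions\<close>

text \<open>
  The permutations in \<^const>\<open>BijGroup\<close> are extensional, whereas actions given by a formula, such as
  conjugation of chains, are not; restricting them bridges the gap.
\<close>

lemma group_actionI:
  assumes "group G"
    and "\<And>g x. g \<in> carrier G \<Longrightarrow> x \<in> E \<Longrightarrow> \<phi> g x \<in> E"
    and "\<And>x. x \<in> E \<Longrightarrow> \<phi> \<one>\<^bsub>G\<^esub> x = x"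
    and "\<And>g h x. g \<in> carrier G \<Longrightarrow> h \<in> carrier G \<Longrightarrow> x \<in> E \<Longrightarrow> \<phi> (g \<otimes>\<^bsub>G\<^esub> h) x = \<phi> g (\<phi> h x)"
  shows "group_action G E (\<lambda>g. restrict (\<phi> g) E)"
proof -
  interpret G: group G by fact
  have bij: "restrict (\<phi> g) E \<in> Bij E" if "g \<in> carrier G" for g
  proof -
    have "bij_betw (\<phi> g) E E"
    proof (rule bij_betwI[where g = "\<phi> (inv\<^bsub>G\<^esub> g)"])
      show "\<phi> (inv\<^bsub>G\<^esub> g) (\<phi> g x) = x" if "x \<in> E" for x
        using assms(3)[OF that] assms(4)[of "inv\<^bsub>G\<^esub> g" g x] that \<open>g \<in> carrier G\<close> by simp
      show "\<phi> g (\<phi> (inv\<^bsub>G\<^esub> g) x) = x" if "x \<in> E" for x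
        using assms(3)[OF that] assms(4)[of g "inv\<^bsub>G\<^esub> g" x] that \<open>g \<in> carrier G\<close> by simp
    qed (use that assms(2) in auto)
    then show ?thesis by (simp add: Bij_def)
  qed
  have "group_hom G (BijGroup E) (\<lambda>g. restrict (\<phi> g) E)"
  proof (rule group_hom.intro[OF _ group_BijGroup], fact, unfold group_hom_axioms_def, rule homI)
    show "restrict (\<phi> g) E \<in> carrier (BijGroup E)" if "g \<in> carrier G" for g
      using bij[OF that] by (simp add: BijGroup_def)
    show "restrict (\<phi> (g \<otimes>\<^bsub>G\<^esub> h)) E = restrict (\<phi> g) E \<otimes>\<^bsub>BijGroup E\<^esub> restrict (\<phi> h) E"
      if "g \<in> carrier G" "h \<in> carrier G" for g h
      using bij that by (auto simp: BijGroup_def compose_def assms(2,4) fun_eq_iff)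
  qed
  then show ?thesis by (simp add: group_action_def)
qed

lemma orbit_eq_iff:
  assumes "group G"
    and "\<And>g x. g \<in> carrier G \<Longrightarrow> x \<in> E \<Longrightarrow> \<phi> g x \<in> E"
    and "\<And>x. x \<in> E \<Longrightarrow> \<phi> \<one>\<^bsub>G\<^esub> x = x"
    and "\<And>g h x. g \<in> carrier G \<Longrightarrow> h \<in> carrier G \<Longrightarrow> x \<in> E \<Longrightarrow> \<phi> (g \<otimes>\<^bsub>G\<^esub> h) x = \<phi> g (\<phi> h x)"
    and xy: "x \<in> E" "y \<in> E"
  shows "orbit G \<phi> x = orbit G \<phi> y \<longleftrightarrow> (\<exists>g\<in>carrier G. y = \<phi> g x)"
proof -
  interpret group_action G E "\<lambda>g. restrict (\<phi> g) E"
    using assms(1-4) by (rule group_actionI)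
  have orb: "orbit G (\<lambda>g. restrict (\<phi> g) E) z = orbit G \<phi> z" if "z \<in> E" for z
    using that by (auto simp: orbit_def)
  have sub: "orbit G \<phi> z \<subseteq> E" if "z \<in> E" for z
    using that assms(2) by (auto simp: orbit_def)
  have "orbit G \<phi> x = orbit G \<phi> y \<longleftrightarrow> y \<in> orbit G \<phi> x"
  proof
    assume "orbit G \<phi> x = orbit G \<phi> y"
    then show "y \<in> orbit G \<phi> x" using orbit_refl[OF xy(2)] orb[OF xy(2)] by simp
  next
    assume y: "y \<in> orbit G \<phi> x"
    then have x: "x \<in> orbit G \<phi> y"
      using orbit_sym[of x y] xy by (simp add: orb)
    show "orbit G \<phi> x = orbit G \<phi> y"
      using orbit_trans[OF xy(1,2)] orbit_trans[OF xy(2,1)] x y xy sub[OF xy(1)] sub[OF xy(2)]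
      by (simp add: orb) blast
  qed
  also have "\<dots> \<longleftrightarrow> (\<exists>g\<in>carrier G. y = \<phi> g x)" by (auto simp: orbit_def)
  finally show ?thesis .
qed

text \<open>
  Every orbit has a power of \<open>p\<close> as its length, and the orbits of length one are the fixed points;
  so \<open>p\<close> divides the lengths of the others.
\<close>

lemma (in group_action) p_group_fixed_points:
  assumes p: "prime p" and k: "order G = p ^ k" and E: "finite E"
  shows "p dvd card (E - {x \<in> E. \<forall>g\<in>carrier G. \<phi> g x = x})"
proof -
  interpret group G using group_hom group_hom.axioms(1) by auto
  define F where "F = {x \<in> E. \<forall>g\<in>carrier G. \<phi> g x = x}"
  have sub: "orbit G \<phi> x \<subseteq> E" if "x \<in> E" for x
    using that element_image by (auto simp: orbit_def)
  have sub': "orbit G \<phi> x \<subseteq> E - F" if "x \<in> E - F" for x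
  proof
    fix y assume y: "y \<in> orbit G \<phi> x"
    show "y \<in> E - F"
    proof (rule ccontr)
      assume "y \<notin> E - F"
      with y sub that have yF: "y \<in> E" "\<forall>g\<in>carrier G. \<phi> g y = y" by (auto simp: F_def)
      have "x \<in> orbit G \<phi> y" using y orbit_sym yF that by blast
      then have "x = y" using yF by (auto simp: orbit_def)
      then show False using that yF by (auto simp: F_def)
    qed
  qed
  have "p dvd card (\<Union>x\<in>E - F. orbit G \<phi> x)"
  proof (rule dvd_partition)
    show "finite (\<Union>x\<in>E - F. orbit G \<phi> x)"
      by (rule finite_subset[OF _ E]) (use sub in auto)
    show "\<forall>c\<in>orbit G \<phi> ` (E - F). p dvd card c"
    proof clarify
      fix x assume x: "x \<in> E" "x \<notin> F"
      have "card (orbit G \<phi> x) dvd p ^ k"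
        using orbit_stabilizer_theorem[OF x(1)] k by (metis dvd_triv_left)
      then obtain j where j: "card (orbit G \<phi> x) = p ^ j"
        using p divides_primepow_nat by blast
      have "j \<noteq> 0"
      proof
        assume "j = 0"
        then obtain z where "orbit G \<phi> x = {z}" using j by (auto simp: card_1_singleton_iff)
        then have "orbit G \<phi> x = {x}" using orbit_refl[OF x(1)] by auto
        then have "x \<in> F" using x(1) by (auto simp: F_def orbit_def)
        then show False using x by simp
      qed
      then show "p dvd card (orbit G \<phi> x)" using j by simp
    qed
    show "\<forall>c1\<in>orbit G \<phi> ` (E - F). \<forall>c2\<in>orbit G \<phi> ` (E - F). c1 \<noteq> c2 \<longrightarrow> c1 \<inter> c2 = {}"
      using disjoint_union by (fastforce simp: orbits_def)
  qed
  also have "(\<Union>x\<in>E - F. orbit G \<phi> x) = E - F"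
    using sub' orbit_refl by blast
  finally show ?thesis by (simp add: F_def)
qed

section \<open>Conjugation of subgroups\<close>

context group
begin

lemma conj_subgroup_image:
  assumes "g \<in> carrier G" "P \<subseteq> carrier G"
  shows "conj_subgroup G g P = (\<lambda>x. g \<otimes> x \<otimes> inv g) ` P"
  using assms by (auto simp: conj_subgroup_def l_coset_def r_coset_def m_assoc subset_iff image_iff)

lemma conj_subgroup_closed:
  "\<lbrakk>g \<in> carrier G; P \<subseteq> carrier G\<rbrakk> \<Longrightarrow> conj_subgroup G g P \<subseteq> carrier G"
  by (auto simp: conj_subgroup_image)

lemma conj_subgroup_one: "P \<subseteq> carrier G \<Longrightarrow> conj_subgroup G \<one> P = P"
  by (force simp: conj_subgroup_image image_iff)

lemma conj_subgroup_mult: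
  assumes "g \<in> carrier G" "h \<in> carrier G" "P \<subseteq> carrier G"
  shows "conj_subgroup G (g \<otimes> h) P = conj_subgroup G g (conj_subgroup G h P)"
proof -
  have "(g \<otimes> h) \<otimes> x \<otimes> inv (g \<otimes> h) = g \<otimes> (h \<otimes> x \<otimes> inv h) \<otimes> inv g" if "x \<in> P" for x
    using assms that by (simp add: m_assoc inv_mult_group subset_iff)
  then show ?thesis
    using assms conj_subgroup_closed[of h P]
    by (simp add: conj_subgroup_image image_image cong: image_cong)
qed

lemma conj_subgroup_inv:
  assumes "g \<in> carrier G" "P \<subseteq> carrier G"
  shows "conj_subgroup G (inv g) (conj_subgroup G g P) = P"
    and "conj_subgroup G g (conj_subgroup G (inv g) P) = P"
  using conj_subgroup_mult[of "inv g" g P] conj_subgroup_mult[of g "inv g" P] assms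
  by (simp_all add: conj_subgroup_one)

lemma conj_subgroup_mono: "P \<subseteq> Q \<Longrightarrow> conj_subgroup G g P \<subseteq> conj_subgroup G g Q"
  by (auto simp: conj_subgroup_def l_coset_def r_coset_def)

lemma conj_subgroup_subset_iff:
  assumes "g \<in> carrier G" "P \<subseteq> carrier G" "Q \<subseteq> carrier G"
  shows "conj_subgroup G g P \<subseteq> conj_subgroup G g Q \<longleftrightarrow> P \<subseteq> Q"
  using conj_subgroup_mono[of P Q] conj_subgroup_inv(1)[of g] assms
    conj_subgroup_mono[of "conj_subgroup G g P" "conj_subgroup G g Q" "inv g"] by metis

lemma conj_subgroup_eq_iff:
  assumes "g \<in> carrier G" "P \<subseteq> carrier G" "Q \<subseteq> carrier G"
  shows "conj_subgroup G g P = conj_subgroup G g Q \<longleftrightarrow> P = Q"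
  using conj_subgroup_inv(1)[of g] assms by metis

lemma card_conj_subgroup:
  assumes "g \<in> carrier G" "P \<subseteq> carrier G"
  shows "card (conj_subgroup G g P) = card P"
proof -
  have "inj_on (\<lambda>x. g \<otimes> x \<otimes> inv g) P"
    using assms by (auto simp: inj_on_def subset_iff)
  then show ?thesis using assms by (simp add: conj_subgroup_image card_image)
qed

lemma subgroup_conj_subgroup:
  assumes "g \<in> carrier G" "subgroup P G"
  shows "subgroup (conj_subgroup G g P) G"
  using subgroup_conjugation_is_surj2[OF assms] assms
  by (simp add: conj_subgroup_def coset_assoc subgroup.subset)

lemma nontrivial_p_subgroup_conj:
  assumes "g \<in> carrier G" "nontrivial_p_subgroup G p P"
  shows "nontrivial_p_subgroup G p (conj_subgroup G g P)"
proof -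
  have sub: "P \<subseteq> carrier G" using assms(2) by (simp add: nontrivial_p_subgroup_def subgroup.subset)
  have "conj_subgroup G g {\<one>} = {\<one>}"
    using assms(1) by (simp add: conj_subgroup_image)
  then have "conj_subgroup G g P \<noteq> {\<one>}"
    using conj_subgroup_eq_iff[OF assms(1) sub, of "{\<one>}"] assms(2)
    by (auto simp: nontrivial_p_subgroup_def)
  then show ?thesis
    using assms sub by (simp add: nontrivial_p_subgroup_def subgroup_conj_subgroup card_conj_subgroup)
qed

lemma normal_iff_conj_subgroup:
  assumes "subgroup P G" "subgroup L G" "P \<subseteq> L"
  shows "P \<lhd> G\<lparr>carrier := L\<rparr> \<longleftrightarrow> (\<forall>x\<in>L. conj_subgroup G x P = P)"
proof -
  interpret L: group "G\<lparr>carrier := L\<rparr>" using assms by (simp add: subgroup_imp_group)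
  have L: "x \<in> carrier G" if "x \<in> L" for x using assms that subgroup.subset by blast
  have P: "P \<subseteq> carrier G" using assms subgroup.subset by blast
  have "P \<lhd> G\<lparr>carrier := L\<rparr> \<longleftrightarrow> (\<forall>x\<in>L. \<forall>h\<in>P. x \<otimes> h \<otimes> inv x \<in> P)"
    using subgroup_incl[OF assms] assms by (simp add: L.normal_inv_iff)
  also have "\<dots> \<longleftrightarrow> (\<forall>x\<in>L. conj_subgroup G x P \<subseteq> P)"
    using L P by (simp add: conj_subgroup_image image_subset_iff)
  also have "\<dots> \<longleftrightarrow> (\<forall>x\<in>L. conj_subgroup G x P = P)"
  proof safe
    fix x y assume *: "\<forall>x\<in>L. conj_subgroup G x P \<subseteq> P" and x: "x \<in> L" "y \<in> P"
    have "conj_subgroup G (inv x) P \<subseteq> P" using * x assms by (simp add: subgroup.m_inv_closed)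
    then have "conj_subgroup G x (conj_subgroup G (inv x) P) \<subseteq> conj_subgroup G x P"
      by (rule conj_subgroup_mono)
    then show "y \<in> conj_subgroup G x P"
      using x L P by (simp add: conj_subgroup_inv subset_iff)
  qed auto
  finally show ?thesis .
qed

lemma conj_subgroup_subgroup:
  "\<lbrakk>subgroup H G; h \<in> H\<rbrakk> \<Longrightarrow> conj_subgroup (G\<lparr>carrier := H\<rparr>) h P = conj_subgroup G h P"
  by (simp add: conj_subgroup_def)

end

section \<open>Sylow subgroups\<close>

context group
begin

text \<open>
  Let \<open>P\<close> act on the right cosets of \<open>Q\<close> by right multiplication. The coset of \<open>h\<close> is fixed
  precisely when the conjugate of \<open>P\<close> by \<open>h\<close> lies in \<open>Q\<close>. For a Sylow subgroup \<open>Q\<close> this yields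
  conjugacy, and for \<open>Q = P\<close> it compares the index of \<open>P\<close> with its index in the normalizer.
\<close>

lemma p_subgroup_fixed_cosets:
  assumes fin: "finite (carrier G)" and p: "prime p"
    and P: "subgroup P G" "card P = p ^ k" and Q: "subgroup Q G"
  shows "p dvd card (rcosets Q - {Q #> h | h. h \<in> carrier G \<and> conj_subgroup G h P \<subseteq> Q})"
proof -
  have subP: "P \<subseteq> carrier G" and subQ: "Q \<subseteq> carrier G"
    using P Q subgroup.subset by blast+
  have inP: "x \<in> carrier G" if "x \<in> P" for x using that subP by blast
  have rc: "rcosets Q = {Q #> h | h. h \<in> carrier G}" by (auto simp: RCOSETS_def)
  interpret P: group "G\<lparr>carrier := P\<rparr>" using P by (simp add: subgroup_imp_group)
  interpret act: group_action "G\<lparr>carrier := P\<rparr>" "rcosets Q"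
    "\<lambda>x. restrict (\<lambda>A. A #> inv x) (rcosets Q)"
  proof (rule group_actionI)
    show "group (G\<lparr>carrier := P\<rparr>)" by (rule P.is_group)
    show "A #> inv g \<in> rcosets Q" if "g \<in> carrier (G\<lparr>carrier := P\<rparr>)" "A \<in> rcosets Q" for g A
      using that inP subQ by (auto simp: rc coset_mult_assoc)
    show "A #> inv \<one>\<^bsub>G\<lparr>carrier := P\<rparr>\<^esub> = A" if "A \<in> rcosets Q" for A
      using that subQ by (auto simp: rc coset_mult_assoc)
    show "A #> inv (g \<otimes>\<^bsub>G\<lparr>carrier := P\<rparr>\<^esub> h) = A #> inv h #> inv g"
      if "g \<in> carrier (G\<lparr>carrier := P\<rparr>)" "h \<in> carrier (G\<lparr>carrier := P\<rparr>)" "A \<in> rcosets Q" for g h A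
      using that inP subQ by (auto simp: rc coset_mult_assoc inv_mult_group m_assoc)
  qed
  have fixed: "Q #> h #> inv x = Q #> h \<longleftrightarrow> h \<otimes> x \<otimes> inv h \<in> Q"
    if "x \<in> P" "h \<in> carrier G" for x h
  proof -
    have "Q #> h #> inv x = Q #> h \<longleftrightarrow> Q #> h = Q #> h #> x"
    proof
      assume *: "Q #> h #> inv x = Q #> h"
      have "Q #> h #> x = Q #> h #> inv x #> x" by (simp only: *)
      also have "\<dots> = Q #> h" using that inP subQ by (simp add: coset_mult_assoc m_assoc)
      finally show "Q #> h = Q #> h #> x" ..
    next
      assume *: "Q #> h = Q #> h #> x"
      have "Q #> h #> inv x = Q #> h #> x #> inv x" using * by simp
      also have "\<dots> = Q #> h" using that inP subQ by (simp add: coset_mult_assoc m_assoc)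
      finally show "Q #> h #> inv x = Q #> h" .
    qed
    also have "\<dots> \<longleftrightarrow> Q #> (h \<otimes> x) = Q #> h"
      using that inP subQ by (auto simp: coset_mult_assoc)
    also have "\<dots> \<longleftrightarrow> Q #> (h \<otimes> x \<otimes> inv h) = Q"
      using that inP subQ coset_mult_inv1[of Q "h \<otimes> x" h] coset_mult_inv2[of Q "h \<otimes> x" h]
      by auto
    also have "\<dots> \<longleftrightarrow> h \<otimes> x \<otimes> inv h \<in> Q"
      using that inP subQ Q coset_join1[of Q "h \<otimes> x \<otimes> inv h"] coset_join2[of "h \<otimes> x \<otimes> inv h" Q]
      by auto
    finally show ?thesis .
  qed
  have "p dvd card (rcosets Q - {A \<in> rcosets Q. \<forall>x\<in>carrier (G\<lparr>carrier := P\<rparr>).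
      restrict (\<lambda>A. A #> inv x) (rcosets Q) A = A})"
  proof (rule act.p_group_fixed_points[OF p])
    show "order (G\<lparr>carrier := P\<rparr>) = p ^ k" using P by (simp add: order_def)
    show "finite (rcosets Q)"
      using fin rcosets_subset_PowG[OF Q] by (meson finite_Pow_iff finite_subset)
  qed
  also have "{A \<in> rcosets Q. \<forall>x\<in>carrier (G\<lparr>carrier := P\<rparr>).
      restrict (\<lambda>A. A #> inv x) (rcosets Q) A = A} =
      {Q #> h | h. h \<in> carrier G \<and> conj_subgroup G h P \<subseteq> Q}"
  proof (rule Set.set_eqI)
    fix A
    have key: "conj_subgroup G h P \<subseteq> Q \<longleftrightarrow> (\<forall>x\<in>P. Q #> h #> inv x = Q #> h)"
      if "h \<in> carrier G" for h
      using fixed that subP by (simp add: conj_subgroup_image image_subset_iff)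
    have R: "A \<in> {Q #> h | h. h \<in> carrier G \<and> conj_subgroup G h P \<subseteq> Q} \<longleftrightarrow>
        (\<exists>h. A = Q #> h \<and> h \<in> carrier G \<and> (\<forall>x\<in>P. A #> inv x = A))"
      using key by auto
    have L: "A \<in> {A \<in> rcosets Q. \<forall>x\<in>carrier (G\<lparr>carrier := P\<rparr>).
        restrict (\<lambda>A. A #> inv x) (rcosets Q) A = A} \<longleftrightarrow>
      A \<in> rcosets Q \<and> (\<forall>x\<in>P. A #> inv x = A)"
      by (simp cong: conj_cong)
    show "A \<in> {A \<in> rcosets Q. \<forall>x\<in>carrier (G\<lparr>carrier := P\<rparr>).
        restrict (\<lambda>A. A #> inv x) (rcosets Q) A = A} \<longleftrightarrow>
      A \<in> {Q #> h | h. h \<in> carrier G \<and> conj_subgroup G h P \<subseteq> Q}"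
      unfolding L R by (auto simp: rc)
  qed
  finally show ?thesis .
qed

lemma sylow_subgroup_iff:
  assumes fin: "finite (carrier G)" and p: "prime p"
  shows "sylow_subgroup G p P \<longleftrightarrow>
    subgroup P G \<and> (\<exists>k. card P = p ^ k) \<and> \<not> p dvd card (rcosets P)"
proof (cases "subgroup P G \<and> (\<exists>k. card P = p ^ k)")
  case True
  then obtain k where P: "subgroup P G" and k: "card P = p ^ k" by blast
  have ord: "order G = card (rcosets P) * p ^ k" using lagrange[OF P] k by simp
  have "order G \<noteq> 0" using fin by (simp add: order_def card_eq_0_iff) (use one_closed in blast)
  then have nz: "card (rcosets P) \<noteq> 0" using ord by auto
  have "multiplicity p (order G) = multiplicity p (card (rcosets P)) + k"
    unfolding ord using nz p
    by (subst prime_elem_multiplicity_mult_distrib) (auto simp: prime_gt_0_nat)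
  then have "card P = p ^ multiplicity p (order G) \<longleftrightarrow> multiplicity p (card (rcosets P)) = 0"
    using k p prime_gt_1_nat[OF p] by (simp add: power_inject_exp)
  also have "\<dots> \<longleftrightarrow> \<not> p dvd card (rcosets P)"
    using nz p prime_gt_1_nat[OF p] by (auto simp: multiplicity_eq_zero_iff)
  finally show ?thesis using P k by (auto simp: sylow_subgroup_def)
qed (auto simp: sylow_subgroup_def)

lemma ex_sylow_subgroup:
  assumes "finite (carrier G)" "prime p"
  shows "\<exists>P. sylow_subgroup G p P"
proof -
  have "order G = p ^ multiplicity p (order G) * (order G div p ^ multiplicity p (order G))"
    by (simp add: multiplicity_dvd)
  from sylow_thm[OF assms(2) is_group this assms(1)] show ?thesis
    by (auto simp: sylow_subgroup_def)
qed

lemma p_subgroup_conj_le_sylow: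
  assumes fin: "finite (carrier G)" and p: "prime p"
    and P: "subgroup P G" "card P = p ^ k" and Q: "sylow_subgroup G p Q"
  shows "\<exists>h\<in>carrier G. conj_subgroup G h P \<subseteq> Q"
proof (rule ccontr)
  assume "\<not> ?thesis"
  then have "{Q #> h | h. h \<in> carrier G \<and> conj_subgroup G h P \<subseteq> Q} = {}" by auto
  moreover have "p dvd card (rcosets Q - {Q #> h | h. h \<in> carrier G \<and> conj_subgroup G h P \<subseteq> Q})"
    using p_subgroup_fixed_cosets[OF fin p P] Q by (simp add: sylow_subgroup_def)
  ultimately have "p dvd card (rcosets Q)" by (metis Diff_empty)
  then show False using Q sylow_subgroup_iff[OF fin p] by blast
qed

lemma sylow_subgroups_conj:
  assumes fin: "finite (carrier G)" and p: "prime p"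
    and P: "sylow_subgroup G p P" and Q: "sylow_subgroup G p Q"
  shows "\<exists>h\<in>carrier G. Q = conj_subgroup G h P"
proof -
  have sub: "P \<subseteq> carrier G" "Q \<subseteq> carrier G"
    using P Q by (auto simp: sylow_subgroup_def subgroup.subset)
  from p_subgroup_conj_le_sylow[OF fin p _ _ Q] P
  obtain h where h: "h \<in> carrier G" "conj_subgroup G h P \<subseteq> Q"
    unfolding sylow_subgroup_def by blast
  have "card (conj_subgroup G h P) = card Q"
    using P Q h sub by (simp add: card_conj_subgroup sylow_subgroup_def)
  then have "conj_subgroup G h P = Q"
    using h sub fin by (meson card_subset_eq finite_subset)
  then show ?thesis using h by blast
qed

lemma sylow_subgroup_of_subgroup:
  assumes fin: "finite (carrier G)" and p: "prime p"
    and P: "sylow_subgroup G p P" and H: "subgroup H G" "P \<subseteq> H"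
  shows "sylow_subgroup (G\<lparr>carrier := H\<rparr>) p P"
proof -
  interpret H: group "G\<lparr>carrier := H\<rparr>" using H by (simp add: subgroup_imp_group)
  have PH: "subgroup P (G\<lparr>carrier := H\<rparr>)"
    using P H by (simp add: subgroup_incl sylow_subgroup_def)
  have 1: "card (rcosets\<^bsub>G\<lparr>carrier := H\<rparr>\<^esub> P) * card P = card H"
    using H.lagrange[OF PH] by (simp add: order_def)
  have 2: "card (rcosets P) * card P = order G"
    using lagrange[of P] P unfolding sylow_subgroup_def by blast
  have 3: "card (rcosets H) * card H = order G" using lagrange H by simp
  have "card P > 0" using P prime_gt_0_nat[OF p] by (simp add: sylow_subgroup_def)
  then have "card (rcosets P) = card (rcosets H) * card (rcosets\<^bsub>G\<lparr>carrier := H\<rparr>\<^esub> P)"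
    using 1 2 3 by (metis mult.assoc mult_cancel2 less_numeral_extra(3))
  moreover have "finite (carrier (G\<lparr>carrier := H\<rparr>))"
    using fin finite_subset[OF subgroup.subset[OF H(1)]] by simp
  ultimately show ?thesis
    using P PH sylow_subgroup_iff[OF fin p] H.sylow_subgroup_iff[OF _ p] by auto
qed

end

section \<open>Normalizers of chains\<close>

context group
begin

lemma conj_chain_one: "\<forall>P\<in>set Ps. P \<subseteq> carrier G \<Longrightarrow> conj_chain G \<one> Ps = Ps"
  by (simp add: conj_chain_def conj_subgroup_one map_idI)

lemma conj_chain_mult:
  "\<lbrakk>g \<in> carrier G; h \<in> carrier G; \<forall>P\<in>set Ps. P \<subseteq> carrier G\<rbrakk> \<Longrightarrow>
    conj_chain G (g \<otimes> h) Ps = conj_chain G g (conj_chain G h Ps)"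
  by (simp add: conj_chain_def conj_subgroup_mult)

lemma conj_chain_inv:
  "\<lbrakk>g \<in> carrier G; \<forall>P\<in>set Ps. P \<subseteq> carrier G\<rbrakk> \<Longrightarrow>
    conj_chain G (inv g) (conj_chain G g Ps) = Ps"
  by (simp add: conj_chain_def map_idI conj_subgroup_inv)

end

definition chain_normalizer :: "('a, 'm) monoid_scheme \<Rightarrow> 'a set list \<Rightarrow> 'a set" where
  "chain_normalizer G Ps = {g \<in> carrier G. conj_chain G g Ps = Ps}"

context group
begin

lemma chain_normalizer_Nil: "chain_normalizer G [] = carrier G"
  by (simp add: chain_normalizer_def conj_chain_def)

lemma chain_normalizer_append:
  "chain_normalizer G (Ps @ [Q]) = {g \<in> chain_normalizer G Ps. conj_subgroup G g Q = Q}"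
  by (auto simp: chain_normalizer_def conj_chain_def)

lemma subgroup_chain_normalizer:
  assumes "\<forall>P\<in>set Ps. P \<subseteq> carrier G"
  shows "subgroup (chain_normalizer G Ps) G"
proof (rule subgroupI)
  show "chain_normalizer G Ps \<subseteq> carrier G" by (auto simp: chain_normalizer_def)
  show "chain_normalizer G Ps \<noteq> {}"
    using conj_chain_one[OF assms] by (auto simp: chain_normalizer_def)
  show "inv g \<in> chain_normalizer G Ps" if "g \<in> chain_normalizer G Ps" for g
    using that conj_chain_inv[of g Ps] assms by (simp add: chain_normalizer_def)
  show "g \<otimes> h \<in> chain_normalizer G Ps"
    if "g \<in> chain_normalizer G Ps" "h \<in> chain_normalizer G Ps" for g h
    using that assms by (simp add: chain_normalizer_def conj_chain_mult)
qed

text \<open>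
  By \<open>p_subgroup_fixed_cosets\<close> with \<open>Q = P\<close>, the index of \<open>P\<close> in \<open>G\<close> is congruent modulo \<open>p\<close> to its index
  in the normalizer, which is prime to \<open>p\<close>.
\<close>

lemma sylow_subgroup_of_normalizer:
  assumes fin: "finite (carrier G)" and p: "prime p" and P: "subgroup P G"
    and syl: "sylow_subgroup (G\<lparr>carrier := {h \<in> carrier G. conj_subgroup G h P = P}\<rparr>) p P"
  shows "sylow_subgroup G p P"
proof -
  define N where "N = {h \<in> carrier G. conj_subgroup G h P = P}"
  have subP: "P \<subseteq> carrier G" using P subgroup.subset by blast
  have N: "subgroup N G"
    using subgroup_chain_normalizer[of "[P]"] subP
    by (simp add: chain_normalizer_def conj_chain_def N_def)
  interpret N: group "G\<lparr>carrier := N\<rparr>" using N by (simp add: subgroup_imp_group)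
  have finN: "finite (carrier (G\<lparr>carrier := N\<rparr>))"
    using fin finite_subset[OF subgroup.subset[OF N]] by simp
  obtain k where k: "card P = p ^ k" using syl by (auto simp: sylow_subgroup_def)
  have eq: "conj_subgroup G h P = P" if "h \<in> carrier G" "conj_subgroup G h P \<subseteq> P" for h
    using that card_subset_eq[of P "conj_subgroup G h P"] finite_subset[OF subP fin]
    by (simp add: card_conj_subgroup[OF _ subP])
  have fixed: "{P #> h | h. h \<in> carrier G \<and> conj_subgroup G h P \<subseteq> P} = rcosets\<^bsub>G\<lparr>carrier := N\<rparr>\<^esub> P"
    using eq by (fastforce simp: RCOSETS_def N_def)
  have "\<not> p dvd card (rcosets\<^bsub>G\<lparr>carrier := N\<rparr>\<^esub> P)"
    using syl N.sylow_subgroup_iff[OF finN p] by (simp add: N_def)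
  moreover have "p dvd card (rcosets P - rcosets\<^bsub>G\<lparr>carrier := N\<rparr>\<^esub> P)"
    using p_subgroup_fixed_cosets[OF fin p P k P] by (simp add: fixed)
  moreover have "finite (rcosets P)"
    using fin rcosets_subset_PowG[OF P] by (meson finite_Pow_iff finite_subset)
  moreover have "rcosets\<^bsub>G\<lparr>carrier := N\<rparr>\<^esub> P \<subseteq> rcosets P"
    by (auto simp: RCOSETS_def N_def)
  ultimately have "\<not> p dvd card (rcosets P)"
    using card_Int_Diff[of "rcosets P" "rcosets\<^bsub>G\<lparr>carrier := N\<rparr>\<^esub> P"]
    by (simp add: Int_absorb1 dvd_add_left_iff)
  then show ?thesis using P k sylow_subgroup_iff[OF fin p] by blast
qed

end

section \<open>Quotients of simplicial sets by group actions\<close>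

locale sset_action = group G + simplicial_set X
  for G (structure) and X :: "'x sset" +
  fixes \<phi> :: "'a \<Rightarrow> 'x \<Rightarrow> 'x"
  assumes act_closed: "\<lbrakk>g \<in> carrier G; x \<in> simplices X n\<rbrakk> \<Longrightarrow> \<phi> g x \<in> simplices X n"
    and act_one: "x \<in> simplices X n \<Longrightarrow> \<phi> \<one> x = x"
    and act_mult: "\<lbrakk>g \<in> carrier G; h \<in> carrier G; x \<in> simplices X n\<rbrakk> \<Longrightarrow>
      \<phi> (g \<otimes> h) x = \<phi> g (\<phi> h x)"
    and act_face: "\<lbrakk>g \<in> carrier G; x \<in> simplices X (Suc n); i \<le> Suc n\<rbrakk> \<Longrightarrow>
      face X (Suc n) i (\<phi> g x) = \<phi> g (face X (Suc n) i x)"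
    and act_degen: "\<lbrakk>g \<in> carrier G; x \<in> simplices X n; i \<le> n\<rbrakk> \<Longrightarrow>
      degen X n i (\<phi> g x) = \<phi> g (degen X n i x)"
begin

abbreviation (input) XG :: "'x set sset" where
  "XG \<equiv> sset_quotient G \<phi> X"

abbreviation (input) orb :: "'x \<Rightarrow> 'x set" where
  "orb \<equiv> orbit G \<phi>"

lemma orb_eq_iff:
  assumes "x \<in> simplices X n" "y \<in> simplices X n"
  shows "orb x = orb y \<longleftrightarrow> (\<exists>g\<in>carrier G. y = \<phi> g x)"
  by (rule orbit_eq_iff[OF is_group act_closed act_one act_mult assms])

lemma orb_refl: "x \<in> simplices X n \<Longrightarrow> x \<in> orb x"
  unfolding orbit_def using act_one by force

lemma simplices_quotient: "simplices XG n = orb ` simplices X n"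
  by (auto simp: sset_quotient_def orbits_def)

lemma face_quotient:
  "\<lbrakk>x \<in> simplices X (Suc n); i \<le> Suc n\<rbrakk> \<Longrightarrow>
    face XG (Suc n) i (orb x) = orb (face X (Suc n) i x)"
  by (force simp: sset_quotient_def orbit_def act_face)

lemma degen_quotient:
  "\<lbrakk>x \<in> simplices X n; i \<le> n\<rbrakk> \<Longrightarrow> degen XG n i (orb x) = orb (degen X n i x)"
  by (force simp: sset_quotient_def orbit_def act_degen)

lemma simplicial_set_quotient: "simplicial_set XG"
proof (unfold_locales, goal_cases)
  case (1 x n i)
  then show ?case by (auto simp: simplices_quotient face_quotient face_closed)
next
  case (2 x n i)
  then show ?case by (auto simp: simplices_quotient degen_quotient degen_closed)
next
  case (3 x n i j)
  then show ?case
    using face_face[of _ n i j]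
    by (auto simp: simplices_quotient face_quotient face_closed)
next
  case (4 x n i j)
  then show ?case
    using face_degen_below[of _ n i j]
    by (auto simp: simplices_quotient face_quotient face_closed degen_quotient degen_closed)
next
  case (5 x n j i)
  then show ?case
    using face_degen_same[of _ n j i]
    by (auto simp: simplices_quotient face_quotient degen_quotient degen_closed)
next
  case (6 x n j i)
  then show ?case
    using face_degen_above[of _ n j i]
    by (auto simp: simplices_quotient face_quotient face_closed degen_quotient degen_closed)
next
  case (7 x n i j)
  then show ?case
    using degen_degen[of _ n i j]
    by (auto simp: simplices_quotient degen_quotient degen_closed)
qed

text \<open>
  If \<open>x\<close> is conjugate to a degenerate simplex, then equivariance of the degeneracy maps moves the
  conjugation inside, so \<open>x\<close> itself is degenerate.
\<close>

lemma nondegenerate_quotient: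
  assumes x: "x \<in> simplices X n"
  shows "nondegenerate XG n (orb x) \<longleftrightarrow> nondegenerate X n x"
proof -
  have "(\<exists>B\<in>simplices XG m. orb x = degen XG m i B) \<longleftrightarrow> (\<exists>y\<in>simplices X m. x = degen X m i y)"
    if m: "n = Suc m" "i \<le> m" for m i
  proof
    assume "\<exists>B\<in>simplices XG m. orb x = degen XG m i B"
    then obtain y where y: "y \<in> simplices X m" "orb x = orb (degen X m i y)"
      using m by (auto simp: simplices_quotient degen_quotient)
    then obtain g where g: "g \<in> carrier G" "x = \<phi> g (degen X m i y)"
      using orb_eq_iff[of "degen X m i y" n x] x m degen_closed[of y m i] by auto
    then have "x = degen X m i (\<phi> g y)" using y m by (simp add: act_degen)
    then show "\<exists>y\<in>simplices X m. x = degen X m i y" using act_closed g(1) y(1) by blast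
  next
    assume "\<exists>y\<in>simplices X m. x = degen X m i y"
    then show "\<exists>B\<in>simplices XG m. orb x = degen XG m i B"
      using m by (auto simp: simplices_quotient degen_quotient)
  qed
  then show ?thesis
    using x unfolding nondegenerate_def by (auto simp: simplices_quotient) blast+
qed

lemma cells_quotient: "cells XG = {(n, orb x) | n x. nondegenerate X n x}"
proof -
  have "nondegenerate XG n A \<longleftrightarrow> (\<exists>x. A = orb x \<and> nondegenerate X n x)" for n A
  proof (cases "A \<in> simplices XG n")
    case True
    then obtain x where x: "x \<in> simplices X n" "A = orb x"
      by (auto simp: simplices_quotient)
    show ?thesis
    proof
      assume "nondegenerate XG n A"
      then show "\<exists>x. A = orb x \<and> nondegenerate X n x"
        using x nondegenerate_quotient by blast
    next
      assume "\<exists>x. A = orb x \<and> nondegenerate X n x"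
      then show "nondegenerate XG n A"
        using nondegenerate_quotient by (metis nondegenerate_def)
    qed
  qed (auto simp: nondegenerate_def simplices_quotient)
  then show ?thesis by (auto simp: cells_def)
qed

end

section \<open>Deleting and repeating entries of a list\<close>

definition omit :: "nat \<Rightarrow> 'b list \<Rightarrow> 'b list" where
  "omit i xs = take i xs @ drop (Suc i) xs"

definition repeat :: "nat \<Rightarrow> 'b list \<Rightarrow> 'b list" where
  "repeat i xs = take (Suc i) xs @ drop i xs"

lemma length_omit: "i < length xs \<Longrightarrow> length (omit i xs) = length xs - 1"
  by (simp add: omit_def)

lemma length_repeat: "i < length xs \<Longrightarrow> length (repeat i xs) = Suc (length xs)"
  by (simp add: repeat_def)

lemma nth_omit:
  "j < length xs - 1 \<Longrightarrow> i < length xs \<Longrightarrow>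
    omit i xs ! j = (if j < i then xs ! j else xs ! Suc j)"
  by (auto simp: omit_def nth_append min_def)

lemma nth_repeat:
  "j \<le> length xs \<Longrightarrow> i < length xs \<Longrightarrow>
    repeat i xs ! j = (if j \<le> i then xs ! j else xs ! (j - 1))"
  by (auto simp: repeat_def nth_append min_def intro!: arg_cong[where f = "(!) xs"])

lemma set_omit: "set (omit i xs) \<subseteq> set xs"
  by (auto simp: omit_def dest: in_set_takeD in_set_dropD)

lemma set_repeat: "set (repeat i xs) \<subseteq> set xs"
  by (auto simp: repeat_def dest: in_set_takeD in_set_dropD)

lemma repeat_omit:
  assumes "Suc i < length xs" "xs ! i = xs ! Suc i"
  shows "repeat i (omit i xs) = xs"
proof (rule nth_equalityI)
  show "length (repeat i (omit i xs)) = length xs"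
    using assms(1) by (simp add: length_omit length_repeat)
  fix j assume "j < length (repeat i (omit i xs))"
  then have j: "j < length xs" using assms(1) by (simp add: length_omit length_repeat)
  then have "repeat i (omit i xs) ! j = (if j \<le> i then omit i xs ! j else omit i xs ! (j - 1))"
    using assms(1) by (intro nth_repeat) (auto simp: length_omit)
  also have "\<dots> = xs ! j"
    using j assms by (auto simp: nth_omit le_less)
  finally show "repeat i (omit i xs) ! j = xs ! j" .
qed

lemma omit_omit:
  assumes "i \<le> j" "Suc j < length xs"
  shows "omit i (omit (Suc j) xs) = omit j (omit i xs)"
  using assms
  by (intro nth_equalityI) (simp add: length_omit, auto simp: length_omit nth_omit)

lemma omit_repeat_below:
  assumes "i \<le> j" "Suc j < length xs"
  shows "omit i (repeat (Suc j) xs) = repeat j (omit i xs)"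
proof (rule nth_equalityI)
  fix k assume "k < length (omit i (repeat (Suc j) xs))"
  then show "omit i (repeat (Suc j) xs) ! k = repeat j (omit i xs) ! k"
    using assms
    by (cases k) (auto simp: length_omit length_repeat nth_omit nth_repeat)
qed (use assms in \<open>simp add: length_omit length_repeat\<close>)

lemma omit_repeat_same:
  assumes "j < length xs" "i = j \<or> i = Suc j"
  shows "omit i (repeat j xs) = xs"
  using assms
  by (intro nth_equalityI) (auto simp: length_omit length_repeat nth_omit nth_repeat)

lemma omit_repeat_above:
  assumes "j < i" "i < length xs"
  shows "omit (Suc i) (repeat j xs) = repeat j (omit i xs)"
proof (rule nth_equalityI)
  fix k assume "k < length (omit (Suc i) (repeat j xs))"
  then show "omit (Suc i) (repeat j xs) ! k = repeat j (omit i xs) ! k"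
    using assms
    by (cases k) (auto simp: length_omit length_repeat nth_omit nth_repeat)
qed (use assms in \<open>simp add: length_omit length_repeat\<close>)

lemma repeat_repeat:
  assumes "i \<le> j" "j < length xs"
  shows "repeat i (repeat j xs) = repeat (Suc j) (repeat i xs)"
proof (rule nth_equalityI)
  fix k assume "k < length (repeat i (repeat j xs))"
  then show "repeat i (repeat j xs) ! k = repeat (Suc j) (repeat i xs) ! k"
    using assms
    by (cases k) (auto simp: length_repeat nth_repeat)
qed (use assms in \<open>simp add: length_repeat\<close>)

lemma sorted_wrt_subset_last:
  assumes "sorted_wrt (\<subseteq>) Ps" "P \<in> set Ps"
  shows "P \<subseteq> last Ps"
  using assms by (induction Ps rule: rev_induct) (auto simp: sorted_wrt_append)

section \<open>The simplicial set of chains of p-subgroups\<close>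

locale p_chains = group G for G (structure) +
  fixes p :: nat
begin

abbreviation (input) chains :: "nat \<Rightarrow> 'a set list set" where
  "chains \<equiv> simplices (p_sset G p)"

abbreviation (input) strict :: "'a set list \<Rightarrow> bool" where
  "strict \<equiv> sorted_wrt (\<subset>)"

lemma p_simplex_iff:
  "Ps \<in> chains n \<longleftrightarrow> length Ps = Suc n \<and> sorted_wrt (\<subseteq>) Ps \<and>
    (\<forall>P\<in>set Ps. nontrivial_p_subgroup G p P \<and> (\<forall>x\<in>last Ps. conj_subgroup G x P = P))"
proof -
  have "P \<lhd> G\<lparr>carrier := last Ps\<rparr> \<longleftrightarrow> (\<forall>x\<in>last Ps. conj_subgroup G x P = P)"
    if "length Ps = Suc n" "sorted_wrt (\<subseteq>) Ps" "\<forall>P\<in>set Ps. nontrivial_p_subgroup G p P" "P \<in> set Ps" for P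
  proof (rule normal_iff_conj_subgroup)
    have "last Ps \<in> set Ps" using that by (intro last_in_set) auto
    then show "subgroup P G" "subgroup (last Ps) G"
      using that by (auto simp: nontrivial_p_subgroup_def)
    show "P \<subseteq> last Ps" using that by (intro sorted_wrt_subset_last)
  qed
  then show ?thesis unfolding p_sset_def by auto
qed

lemma p_simplex_members:
  assumes "Ps \<in> chains n" "P \<in> set Ps"
  shows "nontrivial_p_subgroup G p P" "subgroup P G" "P \<subseteq> carrier G" "P \<subseteq> last Ps"
  using assms sorted_wrt_subset_last[of Ps P] by (auto simp: p_simplex_iff nontrivial_p_subgroup_def subgroup.subset)

lemma p_simplex_carrier:
  "Ps \<in> chains n \<Longrightarrow> \<forall>P\<in>set Ps. P \<subseteq> carrier G"
  using p_simplex_members by blast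

lemma p_simplex_length: "Ps \<in> chains n \<Longrightarrow> length Ps = Suc n"
  by (simp add: p_simplex_iff)

lemma p_simplex_nonempty: "Ps \<in> chains n \<Longrightarrow> Ps \<noteq> []"
  by (auto simp: p_simplex_iff)

text \<open>
  The top \<open>last Qs\<close> is a member of \<open>Ps\<close>, hence is contained in \<open>last Ps\<close> and normalizes all members
  of \<open>Qs\<close>. This covers faces, degeneracies and the passage to the support of a point.
\<close>

lemma p_simplex_subchain:
  assumes "Ps \<in> chains n"
    and "length Qs = Suc m" "sorted_wrt (\<subseteq>) Qs" "set Qs \<subseteq> set Ps"
  shows "Qs \<in> chains m"
proof -
  have "last Qs \<in> set Qs" using assms by (intro last_in_set) auto
  then have "last Qs \<subseteq> last Ps"
    using p_simplex_members(4)[OF assms(1)] assms(4) by blast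
  then show ?thesis using assms unfolding p_simplex_iff by blast
qed

lemma p_face: "face (p_sset G p) n i Ps = omit i Ps"
  by (simp add: p_sset_def omit_def)

lemma p_degen: "degen (p_sset G p) n i Ps = repeat i Ps"
  by (simp add: p_sset_def repeat_def)

lemma sorted_wrt_subset_nth:
  "sorted_wrt (\<subseteq>) Ps \<Longrightarrow> i \<le> j \<Longrightarrow> j < length Ps \<Longrightarrow> Ps ! i \<subseteq> Ps ! j"
  by (cases "i = j") (auto simp: sorted_wrt_iff_nth_less)

lemma conj_chain_nth: "i < length Ps \<Longrightarrow> conj_chain G g Ps ! i = conj_subgroup G g (Ps ! i)"
  by (simp add: conj_chain_def)

lemma length_conj_chain [simp]: "length (conj_chain G g Ps) = length Ps"
  by (simp add: conj_chain_def)

lemma p_simplex_conj: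
  assumes g: "g \<in> carrier G" and Ps: "Ps \<in> chains n"
  shows "conj_chain G g Ps \<in> chains n"
proof -
  note sub = p_simplex_members(3)[OF Ps]
  have ne: "Ps \<noteq> []" and L: "last Ps \<in> set Ps" using p_simplex_nonempty[OF Ps] by auto
  have "conj_subgroup G x (conj_subgroup G g P) = conj_subgroup G g P"
    if x: "x \<in> conj_subgroup G g (last Ps)" and P: "P \<in> set Ps" for x P
  proof -
    obtain y where y: "y \<in> last Ps" "x = g \<otimes> y \<otimes> inv g"
      using x g sub[OF L] by (auto simp: conj_subgroup_image)
    then have yc: "y \<in> carrier G" using sub[OF L] by blast
    have "conj_subgroup G x (conj_subgroup G g P) = conj_subgroup G (x \<otimes> g) P"
      using y yc g sub[OF P] by (simp add: conj_subgroup_mult)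
    also have "x \<otimes> g = g \<otimes> y" using y yc g by (simp add: m_assoc)
    also have "conj_subgroup G (g \<otimes> y) P = conj_subgroup G g (conj_subgroup G y P)"
      using yc g sub[OF P] by (simp add: conj_subgroup_mult)
    also have "conj_subgroup G y P = P" using Ps y(1) P by (simp add: p_simplex_iff)
    finally show ?thesis .
  qed
  moreover have "sorted_wrt (\<subseteq>) (conj_chain G g Ps)"
    using Ps by (simp add: p_simplex_iff sorted_wrt_iff_nth_less conj_chain_nth conj_subgroup_mono)
  ultimately show ?thesis
    using Ps g ne unfolding p_simplex_iff
    by (auto simp: conj_chain_def last_map nontrivial_p_subgroup_conj)
qed

lemma p_face_closed:
  assumes "Ps \<in> chains (Suc n)" "i \<le> Suc n"
  shows "face (p_sset G p) (Suc n) i Ps \<in> chains n"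
proof (rule p_simplex_subchain[OF assms(1)])
  show "set (face (p_sset G p) (Suc n) i Ps) \<subseteq> set Ps"
    unfolding p_face by (rule set_omit)
  show "length (face (p_sset G p) (Suc n) i Ps) = Suc n"
    using assms by (simp add: p_face p_simplex_iff length_omit)
  have "Ps ! j \<subseteq> Ps ! k" if "j \<le> k" "k \<le> Suc n" for j k
    using assms that by (intro sorted_wrt_subset_nth) (auto simp: p_simplex_iff)
  then show "sorted_wrt (\<subseteq>) (face (p_sset G p) (Suc n) i Ps)"
    using p_simplex_length[OF assms(1)] assms(2)
    by (simp add: sorted_wrt_iff_nth_less p_face length_omit nth_omit)
qed

lemma p_degen_closed:
  assumes "Ps \<in> chains n" "i \<le> n"
  shows "degen (p_sset G p) n i Ps \<in> chains (Suc n)"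
proof (rule p_simplex_subchain[OF assms(1)])
  show "set (degen (p_sset G p) n i Ps) \<subseteq> set Ps"
    unfolding p_degen by (rule set_repeat)
  show "length (degen (p_sset G p) n i Ps) = Suc (Suc n)"
    using assms by (simp add: p_degen p_simplex_iff length_repeat)
  have "Ps ! j \<subseteq> Ps ! k" if "j \<le> k" "k \<le> n" for j k
    using assms that by (intro sorted_wrt_subset_nth) (auto simp: p_simplex_iff)
  then show "sorted_wrt (\<subseteq>) (degen (p_sset G p) n i Ps)"
    using p_simplex_length[OF assms(1)] assms(2)
    by (simp add: sorted_wrt_iff_nth_less p_degen length_repeat nth_repeat)
qed

sublocale sset_action G "p_sset G p" "conj_chain G"
proof (unfold_locales, goal_cases)
  case (1 Ps n i)
  then show ?case by (rule p_face_closed)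
next
  case (2 Ps n i)
  then show ?case by (rule p_degen_closed)
next
  case (3 Ps n i j)
  then show ?case
    using omit_omit[of i "j - 1" Ps] by (simp add: p_face p_simplex_iff)
next
  case (4 Ps n i j)
  then show ?case
    using omit_repeat_below[of i "j - 1" Ps] by (simp add: p_face p_degen p_simplex_iff)
next
  case (5 Ps n j i)
  then show ?case
    using omit_repeat_same[of j Ps i] by (simp add: p_face p_degen p_simplex_iff)
next
  case (6 Ps n j i)
  then show ?case
    using omit_repeat_above[of j "i - 1" Ps] by (simp add: p_face p_degen p_simplex_iff)
next
  case (7 Ps n i j)
  then show ?case
    using repeat_repeat[of i j Ps] by (simp add: p_degen p_simplex_iff)
next
  case (8 g Ps n)
  then show ?case by (rule p_simplex_conj)
next
  case (9 Ps n)
  then show ?case using conj_chain_one p_simplex_carrier by blast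
next
  case (10 g h Ps n)
  then show ?case using conj_chain_mult p_simplex_carrier by blast
next
  case (11 g Ps n i)
  then show ?case by (simp add: p_face omit_def conj_chain_def take_map drop_map)
next
  case (12 g Ps n i)
  then show ?case by (simp add: p_degen repeat_def conj_chain_def take_map drop_map)
qed

lemma not_strict_adjacent:
  assumes "sorted_wrt (\<subseteq>) Ps" "\<not> strict Ps"
  shows "\<exists>i. Suc i < length Ps \<and> Ps ! i = Ps ! Suc i"
proof (rule ccontr)
  assume *: "\<nexists>i. Suc i < length Ps \<and> Ps ! i = Ps ! Suc i"
  have "Ps ! i \<subset> Ps ! j" if "i < j" "j < length Ps" for i j
  proof -
    have "Ps ! i \<subset> Ps ! Suc i"
      using sorted_wrt_subset_nth[OF assms(1), of i "Suc i"] * that by auto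
    also have "\<dots> \<subseteq> Ps ! j" using sorted_wrt_subset_nth[OF assms(1), of "Suc i" j] that by simp
    finally show ?thesis .
  qed
  then show False using assms(2) by (auto simp: sorted_wrt_iff_nth_less)
qed

lemma nondegenerate_p_sset:
  "nondegenerate (p_sset G p) n Ps \<longleftrightarrow> Ps \<in> chains n \<and> strict Ps"
proof (cases "Ps \<in> chains n")
  case True
  have "(\<exists>m i Qs. n = Suc m \<and> i \<le> m \<and> Qs \<in> chains m \<and>
      Ps = degen (p_sset G p) m i Qs) \<longleftrightarrow> \<not> strict Ps" (is "?L \<longleftrightarrow> ?R")
  proof
    assume ?L
    then obtain m i Qs where *: "n = Suc m" "i \<le> m" "Qs \<in> chains m"
      "Ps = repeat i Qs" by (auto simp: p_degen)
    then have "Ps ! i = Ps ! Suc i" "Suc i < length Ps"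
      using p_simplex_length[OF *(3)] by (auto simp: length_repeat nth_repeat)
    then show ?R by (auto simp: sorted_wrt_iff_nth_less)
  next
    assume ?R
    then obtain i where i: "Suc i < length Ps" "Ps ! i = Ps ! Suc i"
      using not_strict_adjacent True p_simplex_iff by blast
    define m where "m = n - 1"
    have m: "n = Suc m" "i \<le> m" using i(1) p_simplex_length[OF True] by (auto simp: m_def)
    have "Ps = degen (p_sset G p) m i (face (p_sset G p) n i Ps)"
      unfolding p_face p_degen using repeat_omit[OF i] by simp
    moreover have "face (p_sset G p) n i Ps \<in> chains m"
      using p_face_closed True m by simp
    ultimately show ?L using m by blast
  qed
  then show ?thesis using True by (simp add: nondegenerate_def)
qed (simp add: nondegenerate_def)

end

section \<open>Barycentric coordinates along a list of vertices\<close>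

text \<open>
  The point \<open>t\<^sub>0 x\<^sub>0 + t\<^sub>1 x\<^sub>1 + \<dots>\<close>. The list may repeat a vertex, and then the weights of its
  occurrences add up.
\<close>

definition bary :: "'v list \<Rightarrow> (nat \<Rightarrow> real) \<Rightarrow> 'v \<Rightarrow> real" where
  "bary xs t v = (\<Sum>i<length xs. if xs ! i = v then t i else 0)"

text \<open>
  The inverse of \<open>bary xs\<close> when \<open>xs\<close> is distinct; entries beyond the list are zero, as points of the
  standard simplex require.
\<close>

definition coords :: "'v list \<Rightarrow> ('v \<Rightarrow> real) \<Rightarrow> nat \<Rightarrow> real" where
  "coords xs \<alpha> i = (if i < length xs then \<alpha> (xs ! i) else 0)"

lemma sum_bary:
  assumes "finite S"
  shows "(\<Sum>v\<in>S. bary xs t v) = (\<Sum>i<length xs. if xs ! i \<in> S then t i else 0)"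
proof -
  have "(\<Sum>v\<in>S. bary xs t v) = (\<Sum>i<length xs. \<Sum>v\<in>S. if xs ! i = v then t i else 0)"
    unfolding bary_def by (rule sum.swap)
  also have "\<dots> = (\<Sum>i<length xs. if xs ! i \<in> S then t i else 0)"
    using assms by (intro sum.cong) auto
  finally show ?thesis .
qed

lemma bary_outside: "v \<notin> set xs \<Longrightarrow> bary xs t v = 0"
  unfolding bary_def by (intro sum.neutral) auto

lemma affine_extension_bary: "affine_extension f (bary xs t) = bary (map f xs) t"
proof
  fix w
  have "affine_extension f (bary xs t) w = (\<Sum>v | v \<in> set xs \<and> f v = w. bary xs t v)"
    unfolding affine_extension_def
    using bary_outside[of _ xs t] by (intro sum.mono_neutral_left) auto
  also have "\<dots> = (\<Sum>i<length xs. if xs ! i \<in> {v \<in> set xs. f v = w} then t i else 0)"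
    by (rule sum_bary) simp
  also have "\<dots> = bary (map f xs) t w"
    unfolding bary_def by (intro sum.cong) auto
  finally show "affine_extension f (bary xs t) w = bary (map f xs) t w" .
qed

lemma sum_skip:
  fixes f :: "nat \<Rightarrow> real"
  assumes "i \<le> m"
  shows "(\<Sum>j<Suc m. f j) = f i + (\<Sum>j<m. f (if j < i then j else Suc j))"
  using assms
proof (induction m)
  case (Suc m)
  show ?case
  proof (cases "i = Suc m")
    case True
    then show ?thesis by (simp add: sum.lessThan_Suc)
  next
    case False
    then have i: "i \<le> m" using Suc.prems by simp
    have "(\<Sum>j<Suc (Suc m). f j) = (\<Sum>j<Suc m. f j) + f (Suc m)" by (rule sum.lessThan_Suc)
    also have "\<dots> = f i + (\<Sum>j<m. f (if j < i then j else Suc j)) + f (Suc m)"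
      using Suc.IH[OF i] by simp
    also have "\<dots> = f i + (\<Sum>j<Suc m. f (if j < i then j else Suc j))"
      using i by (simp add: sum.lessThan_Suc[of _ m])
    finally show ?thesis .
  qed
qed simp

lemma bary_omit:
  assumes "i < length xs"
  shows "bary (omit i xs) t = bary xs (simplical_face i t)"
proof
  fix v
  obtain m where m: "length xs = Suc m" using assms by (cases xs) auto
  have "bary xs (simplical_face i t) v =
      (\<Sum>j<m. (\<lambda>j. if xs ! j = v then simplical_face i t j else 0) (if j < i then j else Suc j))"
    unfolding bary_def m using assms m by (subst sum_skip[of i]) (auto simp: simplical_face_def)
  also have "\<dots> = bary (omit i xs) t v"
    unfolding bary_def length_omit[OF assms] m diff_Suc_1 using assms m
    by (intro sum.cong) (auto simp: nth_omit simplical_face_def)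
  finally show "bary (omit i xs) t v = bary xs (simplical_face i t) v" by simp
qed

lemma bary_repeat:
  assumes "i < length xs"
  shows "bary (repeat i xs) t = bary xs (simplicial_degen i t)"
proof
  fix v
  define g where "g j = (if repeat i xs ! j = v then t j else 0)" for j
  have "bary (repeat i xs) t v = g i + (\<Sum>j<length xs. g (if j < i then j else Suc j))"
    unfolding bary_def length_repeat[OF assms] g_def[symmetric] using assms by (intro sum_skip) simp
  also have "g i = (\<Sum>j<length xs. if j = i then g i else 0)"
    using assms by simp
  also have "\<dots> + (\<Sum>j<length xs. g (if j < i then j else Suc j)) =
      (\<Sum>j<length xs. (if j = i then g i else 0) + g (if j < i then j else Suc j))"
    by (simp add: sum.distrib)
  also have "\<dots> = bary xs (simplicial_degen i t) v"
    unfolding bary_def using assms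
    by (intro sum.cong) (auto simp: g_def nth_repeat simplicial_degen_def)
  finally show "bary (repeat i xs) t v = bary xs (simplicial_degen i t) v" .
qed

lemma bary_coords:
  assumes "distinct xs" "{v. \<alpha> v \<noteq> 0} \<subseteq> set xs"
  shows "bary xs (coords xs \<alpha>) = \<alpha>"
proof
  fix v
  show "bary xs (coords xs \<alpha>) v = \<alpha> v"
  proof (cases "v \<in> set xs")
    case True
    then obtain k where k: "k < length xs" "xs ! k = v" by (auto simp: in_set_conv_nth)
    have "bary xs (coords xs \<alpha>) v = (\<Sum>i<length xs. if i = k then \<alpha> v else 0)"
      unfolding bary_def using k assms(1)
      by (intro sum.cong) (auto simp: coords_def nth_eq_iff_index_eq)
    then show ?thesis using k by simp
  next
    case False
    then show ?thesis using assms(2) by (auto simp: bary_outside)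
  qed
qed

lemma bary_nth:
  assumes "distinct xs" "k < length xs"
  shows "bary xs t (xs ! k) = t k"
proof -
  have "bary xs t (xs ! k) = (\<Sum>i<length xs. if i = k then t k else 0)"
    unfolding bary_def using assms by (intro sum.cong) (auto simp: nth_eq_iff_index_eq)
  then show ?thesis using assms by simp
qed

lemma standard_simplexI:
  assumes "\<And>i. 0 \<le> t i" "\<And>i. n < i \<Longrightarrow> t i = 0" "(\<Sum>i<Suc n. t i) = 1"
  shows "t \<in> standard_simplex n"
proof -
  have "t i \<le> 1" for i
  proof (cases "i \<le> n")
    case True
    then have "t i \<le> (\<Sum>i<Suc n. t i)" using assms(1) by (intro member_le_sum) auto
    then show ?thesis using assms(3) by simp
  qed (use assms(2) in auto)
  then show ?thesis
    using assms by (simp add: standard_simplex_def lessThan_Suc_atMost)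
qed

lemma standard_simplexD:
  assumes "t \<in> standard_simplex n"
  shows "0 \<le> t i" "n < i \<Longrightarrow> t i = 0" "(\<Sum>i<Suc n. t i) = 1"
  using assms by (auto simp: standard_simplex_def lessThan_Suc_atMost)

text \<open>
  With a single vertex repeated throughout, \<open>bary\<close> computes the total weight. The behaviour of the
  total weight under faces and degeneracies is thus a special case of \<open>bary_omit\<close> and
  \<open>bary_repeat\<close>.
\<close>

lemma sum_eq_bary: "(\<Sum>i<n. t i) = bary (replicate n ()) t ()"
  unfolding bary_def by (intro sum.cong) auto

lemma omit_replicate: "i < Suc n \<Longrightarrow> omit i (replicate (Suc n) x) = replicate n x"
  by (intro nth_equalityI) (auto simp: length_omit nth_omit simp del: replicate_Suc)

lemma repeat_replicate: "i < n \<Longrightarrow> repeat i (replicate n x) = replicate (Suc n) x"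
  by (intro nth_equalityI) (auto simp: length_repeat nth_repeat simp del: replicate_Suc)

lemma standard_simplex_face_iff:
  assumes "i \<le> Suc n" "\<And>j. n < j \<Longrightarrow> t j = 0"
  shows "simplical_face i t \<in> standard_simplex (Suc n) \<longleftrightarrow> t \<in> standard_simplex n"
proof -
  have sum: "(\<Sum>j<Suc (Suc n). simplical_face i t j) = (\<Sum>j<Suc n. t j)"
    unfolding sum_eq_bary using assms bary_omit[of i "replicate (Suc (Suc n)) ()" t]
    by (simp only: omit_replicate le_imp_less_Suc length_replicate)
  have face: "simplical_face i t (if j < i then j else Suc j) = t j" for j
    by (simp add: simplical_face_def)
  show ?thesis
  proof
    assume *: "simplical_face i t \<in> standard_simplex (Suc n)"
    show "t \<in> standard_simplex n"
    proof (rule standard_simplexI)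
      show "0 \<le> t j" for j using standard_simplexD(1)[OF *] face[of j] by metis
    qed (use assms sum standard_simplexD(3)[OF *] in auto)
  next
    assume *: "t \<in> standard_simplex n"
    show "simplical_face i t \<in> standard_simplex (Suc n)"
    proof (rule standard_simplexI)
      show "0 \<le> simplical_face i t j" for j
        using standard_simplexD(1)[OF *] by (simp add: simplical_face_def)
      show "simplical_face i t j = 0" if "Suc n < j" for j
        using that assms by (simp add: simplical_face_def)
    qed (use sum standard_simplexD(3)[OF *] in simp)
  qed
qed

lemma standard_simplex_degen:
  assumes "i \<le> n" "t \<in> standard_simplex (Suc n)"
  shows "simplicial_degen i t \<in> standard_simplex n"
proof (rule standard_simplexI)
  note t = standard_simplexD[OF assms(2)]
  show "0 \<le> simplicial_degen i t j" for j using t(1) by (simp add: simplicial_degen_def)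
  show "simplicial_degen i t j = 0" if "n < j" for j
    using that assms(1) t(2) by (simp add: simplicial_degen_def)
  have "(\<Sum>j<Suc n. simplicial_degen i t j) = (\<Sum>j<Suc (Suc n). t j)"
    unfolding sum_eq_bary using assms(1) bary_repeat[of i "replicate (Suc n) ()" t]
    by (simp only: repeat_replicate le_imp_less_Suc length_replicate)
  then show "(\<Sum>j<Suc n. simplicial_degen i t j) = 1" using t(3) by simp
qed

lemma bary_support:
  assumes "t \<in> standard_simplex n" "length xs = Suc n"
  shows "{v. bary xs t v \<noteq> 0} = (\<lambda>i. xs ! i) ` {i. i \<le> n \<and> t i \<noteq> 0}"
proof -
  have "bary xs t v \<noteq> 0 \<longleftrightarrow> (\<exists>i\<le>n. xs ! i = v \<and> t i \<noteq> 0)" for v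
    unfolding bary_def using standard_simplexD(1)[OF assms(1)] assms(2)
    by (subst sum_nonneg_eq_0_iff) (auto simp: less_Suc_eq_le)
  then show ?thesis by auto
qed

section \<open>Quotient maps and realizations\<close>

lemma quotient_map_quotient_space: "quotient_map T (quotient_space T q) q"
proof -
  have "topspace (quotient_space T q) = q ` topspace T" (is "?L = ?R")
  proof
    show "?L \<subseteq> ?R" using openin_quotient_space[of T q ?L] openin_topspace by blast
    have "{x \<in> topspace T. q x \<in> ?R} = topspace T" by auto
    then have "openin (quotient_space T q) ?R"
      by (simp add: openin_quotient_space)
    then show "?R \<subseteq> ?L" by (rule openin_subset)
  qed
  then show ?thesis unfolding quotient_map_def by (simp add: openin_quotient_space)
qed

lemma homeomorphic_space_quotient_maps:
  assumes f: "quotient_map T X f" and h: "quotient_map T Y h"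
    and fibres: "\<And>a b. \<lbrakk>a \<in> topspace T; b \<in> topspace T\<rbrakk> \<Longrightarrow> f a = f b \<longleftrightarrow> h a = h b"
  shows "X homeomorphic_space Y"
proof -
  obtain g where g: "continuous_map X Y g" "\<And>x. x \<in> topspace T \<Longrightarrow> g (f x) = h x"
    using quotient_map_lift_exists[OF f quotient_imp_continuous_map[OF h]] fibres by metis
  obtain k where k: "continuous_map Y X k" "\<And>x. x \<in> topspace T \<Longrightarrow> k (h x) = f x"
    using quotient_map_lift_exists[OF h quotient_imp_continuous_map[OF f]] fibres by metis
  have "homeomorphic_maps X Y g k"
    unfolding homeomorphic_maps_def
    using g k by (auto simp flip: quotient_imp_surjective_map[OF f] quotient_imp_surjective_map[OF h])
  then show ?thesis by (auto simp: homeomorphic_space_def)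
qed

lemma openin_prod_discrete:
  "openin (prod_topology (discrete_topology S) T) W \<longleftrightarrow>
    W \<subseteq> S \<times> topspace T \<and> (\<forall>a\<in>S. openin T {t \<in> topspace T. (a, t) \<in> W})"
proof
  assume W: "openin (prod_topology (discrete_topology S) T) W"
  have "openin T {t \<in> topspace T. (a, t) \<in> W}" if "a \<in> S" for a
    using that by (intro openin_continuous_map_preimage[OF _ W])
      (simp add: continuous_map_pairedI)
  then show "W \<subseteq> S \<times> topspace T \<and> (\<forall>a\<in>S. openin T {t \<in> topspace T. (a, t) \<in> W})"
    using openin_subset[OF W] by simp
next
  assume W: "W \<subseteq> S \<times> topspace T \<and> (\<forall>a\<in>S. openin T {t \<in> topspace T. (a, t) \<in> W})"
  then have "openin (prod_topology (discrete_topology S) T)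
      (\<Union>a\<in>S. {a} \<times> {t \<in> topspace T. (a, t) \<in> W})"
    by (intro openin_Union) (auto simp: openin_prod_Times_iff)
  also have "(\<Union>a\<in>S. {a} \<times> {t \<in> topspace T. (a, t) \<in> W}) = W" using W by auto
  finally show "openin (prod_topology (discrete_topology S) T) W" .
qed

lemma topspace_pre_realization:
  "topspace (pre_realization X) = {(n, x, t). x \<in> simplices X n \<and> t \<in> standard_simplex n}"
  by (auto simp: pre_realization_def)

lemma openin_pre_realization:
  assumes "W \<subseteq> topspace (pre_realization X)"
  shows "openin (pre_realization X) W \<longleftrightarrow>
    (\<forall>n. \<forall>x\<in>simplices X n. openin (subtopology (powertop_real UNIV) (standard_simplex n))
      {t \<in> standard_simplex n. (n, x, t) \<in> W})"
  using assms unfolding topspace_pre_realization unfolding pre_realization_def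
  by (auto simp: openin_sum_topology openin_prod_discrete)

lemma topspace_closed_simplex:
  "topspace (closed_simplex K s) = {\<alpha> \<in> complex_points K. {v. \<alpha> v \<noteq> 0} \<subseteq> s}"
  by (simp add: closed_simplex_def)

lemma topspace_complex_realization: "topspace (complex_realization K) = complex_points K"
proof
  show "topspace (complex_realization K) \<subseteq> complex_points K"
    using openin_complex_realization[of K] openin_topspace by blast
  have "complex_points K \<inter> topspace (closed_simplex K s) = topspace (closed_simplex K s)" for s
    by (auto simp: topspace_closed_simplex)
  then have "openin (complex_realization K) (complex_points K)"
    by (simp add: openin_complex_realization)
  then show "complex_points K \<subseteq> topspace (complex_realization K)" by (rule openin_subset)
qed

lemma continuous_map_bary:
  "continuous_map (subtopology (powertop_real UNIV) S) (powertop_real UNIV) (bary xs)"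
proof -
  have "continuous_map (subtopology (powertop_real UNIV) S) euclideanreal (\<lambda>t. if c then t i else 0)"
    for c :: bool and i :: nat
    by (cases c) (auto intro!: continuous_map_from_subtopology continuous_map_product_projection)
  then show ?thesis
    unfolding continuous_map_componentwise_UNIV bary_def by (auto intro!: continuous_map_sum)
qed

lemma continuous_map_coords:
  "continuous_map (subtopology (powertop_real UNIV) S) (powertop_real UNIV) (coords xs)"
proof -
  have "continuous_map (subtopology (powertop_real UNIV) S) euclideanreal (\<lambda>\<alpha>. if c then \<alpha> v else 0)"
    for c v by (cases c) (auto intro!: continuous_map_from_subtopology continuous_map_product_projection)
  then show ?thesis
    unfolding continuous_map_componentwise_UNIV coords_def by auto
qed

section \<open>The realization of the orbit simplicial set\<close>

lemma strict_sorted_unique: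
  assumes "sorted_wrt (\<subset>) xs" "sorted_wrt (\<subset>) ys" "set xs = set ys"
  shows "xs = ys"
  using assms
proof (induction xs arbitrary: ys)
  case (Cons x xs)
  obtain y zs where ys: "ys = y # zs" using Cons.prems(3) by (cases ys) auto
  have "x = y"
  proof (rule ccontr)
    assume "x \<noteq> y"
    then have "x \<in> set zs" "y \<in> set xs" using Cons.prems(3) by (auto simp: ys)
    then have "y \<subset> x" "x \<subset> y" using Cons.prems(1,2) by (auto simp: ys)
    then show False by blast
  qed
  moreover have "x \<notin> set xs" "y \<notin> set zs" using Cons.prems by (auto simp: ys)
  then have "set xs = set zs" using Cons.prems(3) \<open>x = y\<close> by (auto simp: ys)
  then have "xs = zs" using Cons by (simp add: ys)
  ultimately show ?case by (simp add: ys)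
qed simp

lemma strict_distinct: "sorted_wrt (\<subset>) xs \<Longrightarrow> distinct xs"
  by (induction xs) auto

lemma sorted_wrt_remdups: "sorted_wrt P xs \<Longrightarrow> sorted_wrt P (remdups xs)"
  by (induction xs) auto

context p_chains
begin

abbreviation (input) conj_point :: "'a \<Rightarrow> ('a set \<Rightarrow> real) \<Rightarrow> 'a set \<Rightarrow> real" where
  "conj_point g \<equiv> affine_extension (conj_subgroup G g)"

lemma p_complexE:
  assumes "s \<in> p_complex G p"
  obtains n Ps where "Ps \<in> chains n" "strict Ps" "set Ps = s"
proof -
  obtain Ps where Ps: "s = set Ps" "Ps \<noteq> []" "strict Ps"
    "\<forall>P \<in> set Ps. nontrivial_p_subgroup G p P \<and> P \<lhd> G\<lparr>carrier := last Ps\<rparr>"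
    using assms unfolding p_complex_def by blast
  then have "Ps \<in> chains (length Ps - 1)"
    using sorted_wrt_mono_rel[of Ps "(\<subset>)" "(\<subseteq>)"] by (auto simp: p_sset_def)
  then show ?thesis using that Ps by blast
qed

lemma p_complexI:
  assumes Ps: "Ps \<in> chains n" and s: "s \<subseteq> set Ps" "s \<noteq> {}"
  shows "s \<in> p_complex G p"
proof -
  define Qs where "Qs = remdups (filter (\<lambda>P. P \<in> s) Ps)"
  have set: "set Qs = s" using s by (auto simp: Qs_def)
  then have ne: "Qs \<noteq> []" using s(2) by auto
  have sorted: "sorted_wrt (\<subseteq>) Qs"
    using Ps by (simp add: Qs_def p_simplex_iff sorted_wrt_remdups sorted_wrt_filter)
  have "distinct Qs" by (simp add: Qs_def)
  then have strict: "strict Qs"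
    using not_strict_adjacent[OF sorted] by (metis Suc_lessD n_not_Suc_n nth_eq_iff_index_eq)
  have "Qs \<in> chains (length Qs - 1)"
    using p_simplex_subchain[OF Ps _ sorted, of "length Qs - 1"] ne set s by simp
  then show ?thesis
    using set ne strict unfolding p_complex_def p_sset_def by auto
qed

lemma bary_complex_point:
  assumes Ps: "Ps \<in> chains n" and t: "t \<in> standard_simplex n"
  shows "bary Ps t \<in> complex_points (p_complex G p)"
proof -
  note t' = standard_simplexD[OF t]
  note len = p_simplex_length[OF Ps]
  have nonneg: "0 \<le> bary Ps t v" for v
    unfolding bary_def using t' by (auto intro: sum_nonneg)
  have supp: "{v. bary Ps t v \<noteq> 0} \<subseteq> set Ps" using bary_outside by fastforce
  have "(\<Sum>v | bary Ps t v \<noteq> 0. bary Ps t v) = (\<Sum>v\<in>set Ps. bary Ps t v)"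
    using supp by (intro sum.mono_neutral_left) auto
  also have "\<dots> = 1"
    using t' by (simp add: sum_bary len)
  finally have sum: "(\<Sum>v | bary Ps t v \<noteq> 0. bary Ps t v) = 1" .
  then have "{v. bary Ps t v \<noteq> 0} \<noteq> {}" by (intro notI) simp
  then show ?thesis
    using p_complexI[OF Ps supp] nonneg sum by (simp add: complex_points_def)
qed

lemma coords_simplex:
  assumes Ps: "Ps \<in> chains n" "strict Ps"
    and \<alpha>: "\<alpha> \<in> complex_points (p_complex G p)" "{v. \<alpha> v \<noteq> 0} \<subseteq> set Ps"
  shows "coords Ps \<alpha> \<in> standard_simplex n" "bary Ps (coords Ps \<alpha>) = \<alpha>"
proof -
  note len = p_simplex_length[OF Ps(1)]
  note dist = strict_distinct[OF Ps(2)]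
  show eq: "bary Ps (coords Ps \<alpha>) = \<alpha>" using dist \<alpha>(2) by (rule bary_coords)
  show "coords Ps \<alpha> \<in> standard_simplex n"
  proof (rule standard_simplexI)
    show "0 \<le> coords Ps \<alpha> i" for i using \<alpha>(1) by (simp add: coords_def complex_points_def)
    show "coords Ps \<alpha> i = 0" if "n < i" for i using that len by (simp add: coords_def)
    have "(\<Sum>v\<in>set Ps. \<alpha> v) = (\<Sum>i<Suc n. coords Ps \<alpha> i)"
      using sum_bary[of "set Ps" Ps "coords Ps \<alpha>"] by (simp add: eq len)
    also have "(\<Sum>v\<in>set Ps. \<alpha> v) = (\<Sum>v | \<alpha> v \<noteq> 0. \<alpha> v)"
      using \<alpha>(2) by (intro sum.mono_neutral_right) auto
    finally show "(\<Sum>i<Suc n. coords Ps \<alpha> i) = 1" using \<alpha>(1) by (simp add: complex_points_def)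
  qed
qed

lemma complex_pointE:
  assumes "\<alpha> \<in> complex_points (p_complex G p)"
  obtains n Ps t where "Ps \<in> chains n" "t \<in> standard_simplex n" "\<alpha> = bary Ps t"
proof -
  have "{v. \<alpha> v \<noteq> 0} \<in> p_complex G p" using assms by (simp add: complex_points_def)
  then obtain n Ps where "Ps \<in> chains n" "strict Ps" "set Ps = {v. \<alpha> v \<noteq> 0}"
    by (rule p_complexE)
  then show ?thesis using that coords_simplex[of Ps n \<alpha>] assms by (metis order_refl)
qed

text \<open>
  For \<open>A\<close> the orbit of \<open>Ps\<close>, this is the orbit of the point \<open>bary Ps t\<close>; written as an image it
  needs no choice of a representative.
\<close>

definition orbit_point ::
  "nat \<times> 'a set list set \<times> (nat \<Rightarrow> real) \<Rightarrow> ('a set \<Rightarrow> real) set" where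
  "orbit_point = (\<lambda>(n, A, t). (\<lambda>Ps. bary Ps t) ` A)"

lemma orbit_point: "orbit_point (n, orb Ps, t) = orbit G conj_point (bary Ps t)"
  by (auto simp: orbit_point_def orbit_def affine_extension_bary conj_chain_def)

lemma orbit_point_eqD:
  assumes Ps: "Ps \<in> chains n" and Qs: "Qs \<in> chains m"
    and eq: "orbit_point (n, orb Ps, s) = orbit_point (m, orb Qs, t)"
  obtains g where "g \<in> carrier G" "bary Qs t = bary (conj_chain G g Ps) s"
proof -
  have "bary Qs t \<in> orbit_point (m, orb Qs, t)"
    using orb_refl[OF Qs] by (auto simp: orbit_point_def)
  then show ?thesis
    unfolding eq[symmetric] using that by (auto simp: orbit_point_def orbit_def)
qed

abbreviation (input) realization_equiv ::
  "((nat \<times> 'a set list set \<times> (nat \<Rightarrow> real)) \<times> (nat \<times> 'a set list set \<times> (nat \<Rightarrow> real))) set" where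
  "realization_equiv \<equiv> (realization_rel (p_orbit_sset G p) \<union> (realization_rel (p_orbit_sset G p))\<inverse>)\<^sup>*"

lemma sym_realization_equiv: "(a, b) \<in> realization_equiv \<Longrightarrow> (b, a) \<in> realization_equiv"
  using sym_rtrancl[of "realization_rel (p_orbit_sset G p) \<union> (realization_rel (p_orbit_sset G p))\<inverse>"]
  by (simp add: sym_Un_converse symD)

lemma realization_rel_face:
  assumes "Ps \<in> chains (Suc n)" "i \<le> Suc n" "t \<in> standard_simplex n"
  shows "((n, orb (omit i Ps), t), (Suc n, orb Ps, simplical_face i t)) \<in> realization_rel (p_orbit_sset G p)"
  using assms face_quotient[OF assms(1,2)]
  unfolding realization_rel_def p_orbit_sset_def p_face simplices_quotient by auto

lemma realization_rel_degen:
  assumes "Ps \<in> chains n" "i \<le> n" "t \<in> standard_simplex (Suc n)"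
  shows "((Suc n, orb (repeat i Ps), t), (n, orb Ps, simplicial_degen i t)) \<in> realization_rel (p_orbit_sset G p)"
  using assms degen_quotient[OF assms(1,2)]
  unfolding realization_rel_def p_orbit_sset_def p_degen simplices_quotient by auto

lemma orbit_point_realization_rel:
  assumes "(a, b) \<in> realization_rel (p_orbit_sset G p)"
  shows "orbit_point a = orbit_point b"
  using assms unfolding realization_rel_def
proof (elim UnE)
  assume "(a, b) \<in> {((n, face (p_orbit_sset G p) (Suc n) i x, t), (Suc n, x, simplical_face i t)) | n i x t.
        x \<in> simplices (p_orbit_sset G p) (Suc n) \<and> i \<le> Suc n \<and> t \<in> standard_simplex n}"
  then obtain n i Ps t where *: "Ps \<in> chains (Suc n)" "i \<le> Suc n"
    "a = (n, face (p_orbit_sset G p) (Suc n) i (orb Ps), t)" "b = (Suc n, orb Ps, simplical_face i t)"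
    unfolding p_orbit_sset_def simplices_quotient by auto
  then have "a = (n, orb (omit i Ps), t)"
    using face_quotient[OF *(1,2)] by (simp add: p_orbit_sset_def p_face)
  then show ?thesis
    using *(2,4) p_simplex_length[OF *(1)] by (simp add: orbit_point bary_omit)
next
  assume "(a, b) \<in> {((Suc n, degen (p_orbit_sset G p) n i x, t), (n, x, simplicial_degen i t)) | n i x t.
        x \<in> simplices (p_orbit_sset G p) n \<and> i \<le> n \<and> t \<in> standard_simplex (Suc n)}"
  then obtain n i Ps t where *: "Ps \<in> chains n" "i \<le> n"
    "a = (Suc n, degen (p_orbit_sset G p) n i (orb Ps), t)" "b = (n, orb Ps, simplicial_degen i t)"
    unfolding p_orbit_sset_def simplices_quotient by auto
  then have "a = (Suc n, orb (repeat i Ps), t)"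
    using degen_quotient[OF *(1,2)] by (simp add: p_orbit_sset_def p_degen)
  then show ?thesis
    using *(2,4) p_simplex_length[OF *(1)] by (simp add: orbit_point bary_repeat)
qed

lemma orbit_point_realization_equiv:
  "(a, b) \<in> realization_equiv \<Longrightarrow> orbit_point a = orbit_point b"
  by (induction rule: rtrancl_induct) (auto dest: orbit_point_realization_rel)

text \<open>
  Induction on the dimension: a vanishing coordinate is removed by a face relation, and two equal
  adjacent entries are merged by a degeneracy relation; both lower the dimension.
\<close>

lemma realization_normal_form:
  assumes "Ps \<in> chains n" "t \<in> standard_simplex n"
  shows "\<exists>m Qs s. Qs \<in> chains m \<and> strict Qs \<and> s \<in> standard_simplex m \<and>
    (\<forall>i\<le>m. s i \<noteq> 0) \<and> ((n, orb Ps, t), (m, orb Qs, s)) \<in> realization_equiv"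
  using assms
proof (induction n arbitrary: Ps t rule: less_induct)
  case (less n)
  note Ps = less.prems(1) and t = less.prems(2)
  note len = p_simplex_length[OF Ps]
  consider (zero) i where "i \<le> n" "t i = 0" | (repeat) "\<not> strict Ps"
    | (nf) "\<forall>i\<le>n. t i \<noteq> 0" "strict Ps" by blast
  then show ?case
  proof cases
    case zero
    have "n \<noteq> 0" using standard_simplexD(3)[OF t] zero by (intro notI) simp
    then obtain n' where n': "n = Suc n'" by (cases n) auto
    define s where "s = (\<lambda>j. if j < i then t j else t (Suc j))"
    have face: "simplical_face i s = t"
      using zero by (auto simp: fun_eq_iff simplical_face_def s_def)
    have s: "s \<in> standard_simplex n'"
      using standard_simplex_face_iff[of i n' s] standard_simplexD(2)[OF t] t zero(1)
      by (simp add: n' face) (simp add: s_def n')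
    have chain: "omit i Ps \<in> chains n'"
      using p_face_closed[of Ps n' i] Ps zero(1) by (simp add: n' p_face)
    have "((n, orb Ps, t), (n', orb (omit i Ps), s)) \<in> realization_equiv"
      using realization_rel_face[of Ps n' i s] Ps zero(1) s by (intro r_into_rtrancl) (simp add: n' face)
    then show ?thesis
      using less.IH[OF _ chain s] rtrancl_trans[of "(n, orb Ps, t)"] n' by (meson lessI)
  next
    case repeat
    then obtain i where i: "Suc i < length Ps" "Ps ! i = Ps ! Suc i"
      using not_strict_adjacent Ps p_simplex_iff by blast
    obtain n' where n': "n = Suc n'" using i len by (cases n) auto
    have chain: "omit i Ps \<in> chains n'"
      using p_face_closed[of Ps n' i] Ps i(1) len by (simp add: n' p_face)
    have s: "simplicial_degen i t \<in> standard_simplex n'"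
      using standard_simplex_degen[of i n' t] i len t by (simp add: n')
    have "((n, orb Ps, t), (n', orb (omit i Ps), simplicial_degen i t)) \<in> realization_equiv"
      using realization_rel_degen[OF chain, of i t] i len t repeat_omit[OF i]
      by (intro r_into_rtrancl) (simp add: n')
    then show ?thesis
      using less.IH[OF _ chain s] rtrancl_trans[of "(n, orb Ps, t)"] n' by (meson lessI)
  next
    case nf
    then show ?thesis using Ps t by blast
  qed
qed

text \<open>
  The support of the point is the set of members of the chain, and a strict chain is determined by
  its set of members. The weights are then the values of the point at the members.
\<close>

lemma normal_form_unique:
  assumes Ps: "Ps \<in> chains n" "strict Ps"
    and s: "s \<in> standard_simplex n" "\<forall>i\<le>n. s i \<noteq> 0"
    and Qs: "Qs \<in> chains m" "strict Qs"
    and t: "t \<in> standard_simplex m" "\<forall>i\<le>m. t i \<noteq> 0"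
    and eq: "bary Ps s = bary Qs t"
  shows "n = m" "Ps = Qs" "s = t"
proof -
  have supp: "{v. bary Rs r v \<noteq> 0} = set Rs"
    if "Rs \<in> chains k" "r \<in> standard_simplex k" "\<forall>i\<le>k. r i \<noteq> 0" for Rs k r
  proof -
    have "{v. bary Rs r v \<noteq> 0} = (\<lambda>i. Rs ! i) ` {i. i < length Rs}"
      using that(3) p_simplex_length[OF that(1)] bary_support[OF that(2), of Rs]
      by (auto simp: less_Suc_eq_le)
    also have "\<dots> = set Rs" by (auto simp: in_set_conv_nth)
    finally show ?thesis .
  qed
  have "set Ps = set Qs" using supp[OF Ps(1) s] supp[OF Qs(1) t] eq by simp
  then show Ps_eq: "Ps = Qs" by (rule strict_sorted_unique[OF Ps(2) Qs(2)])
  then show nm: "n = m" using p_simplex_length[OF Ps(1)] p_simplex_length[OF Qs(1)] by simp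
  show "s = t"
  proof
    fix i
    show "s i = t i"
    proof (cases "i \<le> n")
      case True
      then show ?thesis
        using bary_nth[OF strict_distinct[OF Ps(2)], of i] eq p_simplex_length[OF Ps(1)] Ps_eq
        by (metis less_Suc_eq_le)
    next
      case False
      then show ?thesis using standard_simplexD(2)[OF s(1)] standard_simplexD(2)[OF t(1)] nm by simp
    qed
  qed
qed

lemma orbit_point_eq_iff:
  assumes a: "a \<in> topspace (pre_realization (p_orbit_sset G p))"
    and b: "b \<in> topspace (pre_realization (p_orbit_sset G p))"
  shows "orbit_point a = orbit_point b \<longleftrightarrow> (a, b) \<in> realization_equiv"
proof
  assume eq: "orbit_point a = orbit_point b"
  obtain n Ps s where Ps: "Ps \<in> chains n" "s \<in> standard_simplex n" "a = (n, orb Ps, s)"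
    using a unfolding topspace_pre_realization p_orbit_sset_def simplices_quotient by blast
  obtain m Qs t where Qs: "Qs \<in> chains m" "t \<in> standard_simplex m" "b = (m, orb Qs, t)"
    using b unfolding topspace_pre_realization p_orbit_sset_def simplices_quotient by blast
  obtain n' Ps' s' where P: "Ps' \<in> chains n'" "strict Ps'"
    "s' \<in> standard_simplex n'" "\<forall>i\<le>n'. s' i \<noteq> 0" and aP: "(a, (n', orb Ps', s')) \<in> realization_equiv"
    using realization_normal_form[OF Ps(1,2)] Ps(3) by blast
  obtain m' Qs' t' where Q: "Qs' \<in> chains m'" "strict Qs'"
    "t' \<in> standard_simplex m'" "\<forall>i\<le>m'. t' i \<noteq> 0" and bQ: "(b, (m', orb Qs', t')) \<in> realization_equiv"
    using realization_normal_form[OF Qs(1,2)] Qs(3) by blast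
  have "orbit_point (n', orb Ps', s') = orbit_point (m', orb Qs', t')"
    using eq orbit_point_realization_equiv[OF aP] orbit_point_realization_equiv[OF bQ] by simp
  then obtain g where g: "g \<in> carrier G" "bary Qs' t' = bary (conj_chain G g Ps') s'"
    by (rule orbit_point_eqD[OF P(1) Q(1)])
  have gP: "conj_chain G g Ps' \<in> chains n'" by (rule p_simplex_conj[OF g(1) P(1)])
  have orb_eq: "orb Ps' = orb (conj_chain G g Ps')" using orb_eq_iff[OF P(1) gP] g(1) by blast
  have "strict (conj_chain G g Ps')"
    using P(1) P(2) gP nondegenerate_quotient orb_eq nondegenerate_p_sset by metis
  then have "m' = n'" "Qs' = conj_chain G g Ps'" "t' = s'"
    using normal_form_unique[OF Q gP _ P(3,4) g(2)] by auto
  then have "(b, (n', orb Ps', s')) \<in> realization_equiv" using bQ orb_eq by simp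
  from rtrancl_trans[OF aP sym_realization_equiv[OF this]]
  show "(a, b) \<in> realization_equiv" .
qed (rule orbit_point_realization_equiv)

text \<open>
  Openness is tested on the closed simplices of the complex, and on the pieces \<open>{A} \<times> \<Delta>\<^sup>n\<close> of the
  disjoint union. Passing the first test implies passing the second, because \<open>bary Ps\<close> is a
  continuous map from \<open>\<Delta>\<^sup>n\<close> to the closed simplex on the members of \<open>Ps\<close>. Conversely, every closed
  simplex comes from a strict chain \<open>Ps\<close>, and then the continuous map \<open>coords Ps\<close> leads back to
  \<open>\<Delta>\<^sup>n\<close>.
\<close>

lemma quotient_map_orbit_point:
  "quotient_map (pre_realization (p_orbit_sset G p)) (p_complex_orbit_space G p) orbit_point"
proof -
  let ?K = "p_complex G p" and ?X = "p_orbit_sset G p"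
  have q: "quotient_map (complex_realization ?K) (p_complex_orbit_space G p) (orbit G conj_point)"
    unfolding p_complex_orbit_space_def orbit_space_def by (rule quotient_map_quotient_space)
  then have top: "topspace (p_complex_orbit_space G p) = orbit G conj_point ` complex_points ?K"
    using quotient_imp_surjective_map by (metis topspace_complex_realization)
  have "orbit_point ` topspace (pre_realization ?X) = orbit G conj_point ` complex_points ?K"
  proof (intro equalityI subsetI)
    fix y assume "y \<in> orbit_point ` topspace (pre_realization ?X)"
    then obtain n Ps t where "Ps \<in> chains n" "t \<in> standard_simplex n"
      "y = orbit_point (n, orb Ps, t)"
      unfolding topspace_pre_realization p_orbit_sset_def simplices_quotient by blast
    then show "y \<in> orbit G conj_point ` complex_points ?K"
      using bary_complex_point by (simp add: orbit_point)
  next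
    fix y assume "y \<in> orbit G conj_point ` complex_points ?K"
    then obtain n Ps t where "Ps \<in> chains n" "t \<in> standard_simplex n"
      "y = orbit G conj_point (bary Ps t)" by (blast elim: complex_pointE)
    then have "y = orbit_point (n, orb Ps, t)"
      "(n, orb Ps, t) \<in> topspace (pre_realization ?X)"
      unfolding topspace_pre_realization p_orbit_sset_def simplices_quotient orbit_point by auto
    then show "y \<in> orbit_point ` topspace (pre_realization ?X)" by blast
  qed
  moreover have "openin (pre_realization ?X) {a \<in> topspace (pre_realization ?X). orbit_point a \<in> U} \<longleftrightarrow>
      openin (p_complex_orbit_space G p) U" if U: "U \<subseteq> topspace (p_complex_orbit_space G p)" for U
  proof -
    define V where "V = {\<alpha> \<in> complex_points ?K. orbit G conj_point \<alpha> \<in> U}"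
    have "openin (p_complex_orbit_space G p) U \<longleftrightarrow> openin (complex_realization ?K) V"
      using q U unfolding quotient_map_def V_def topspace_complex_realization by simp
    also have "\<dots> \<longleftrightarrow> (\<forall>s\<in>?K. openin (closed_simplex ?K s) (V \<inter> topspace (closed_simplex ?K s)))"
    proof -
      have "V \<subseteq> complex_points ?K" by (auto simp: V_def)
      then show ?thesis unfolding openin_complex_realization by simp
    qed
    also have "\<dots> \<longleftrightarrow> (\<forall>n. \<forall>Ps\<in>chains n.
        openin (subtopology (powertop_real UNIV) (standard_simplex n))
          {t \<in> standard_simplex n. bary Ps t \<in> V})" (is "?L \<longleftrightarrow> ?R")
    proof
      assume L: ?L
      show ?R
      proof (intro allI ballI)
        fix n Ps assume Ps: "Ps \<in> chains n"
        have supp: "{v. bary Ps t v \<noteq> 0} \<subseteq> set Ps" for t using bary_outside by fastforce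
        have cont: "continuous_map (subtopology (powertop_real UNIV) (standard_simplex n))
            (closed_simplex ?K (set Ps)) (bary Ps)"
          unfolding closed_simplex_def
          using continuous_map_bary bary_complex_point[OF Ps] supp
          by (intro continuous_map_into_subtopology) auto
        have "set Ps \<in> ?K" using p_complexI[OF Ps, of "set Ps"] p_simplex_nonempty[OF Ps] by simp
        then have "openin (closed_simplex ?K (set Ps)) (V \<inter> topspace (closed_simplex ?K (set Ps)))"
          using L by blast
        from openin_continuous_map_preimage[OF cont this]
        show "openin (subtopology (powertop_real UNIV) (standard_simplex n))
            {t \<in> standard_simplex n. bary Ps t \<in> V}"
          using bary_complex_point[OF Ps] supp by (simp add: topspace_closed_simplex cong: conj_cong)
      qed
    next
      assume R: ?R
      show ?L
      proof
        fix s assume "s \<in> ?K"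
        then obtain n Ps where Ps: "Ps \<in> chains n" "strict Ps" "set Ps = s"
          by (rule p_complexE)
        have cont: "continuous_map (closed_simplex ?K s)
            (subtopology (powertop_real UNIV) (standard_simplex n)) (coords Ps)"
          using coords_simplex(1)[OF Ps(1,2)] Ps(3) continuous_map_coords
          by (intro continuous_map_into_subtopology) (auto simp: closed_simplex_def)
        have "openin (subtopology (powertop_real UNIV) (standard_simplex n))
          {t \<in> standard_simplex n. bary Ps t \<in> V}" using R Ps(1) by blast
        from openin_continuous_map_preimage[OF cont this]
        have "openin (closed_simplex ?K s) {\<alpha> \<in> topspace (closed_simplex ?K s).
            coords Ps \<alpha> \<in> {t \<in> standard_simplex n. bary Ps t \<in> V}}" .
        also have "{\<alpha> \<in> topspace (closed_simplex ?K s).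
            coords Ps \<alpha> \<in> {t \<in> standard_simplex n. bary Ps t \<in> V}} = V \<inter> topspace (closed_simplex ?K s)"
          using coords_simplex[OF Ps(1,2)] Ps(3) by (auto simp: topspace_closed_simplex)
        finally show "openin (closed_simplex ?K s) (V \<inter> topspace (closed_simplex ?K s))" .
      qed
    qed
    also have "\<dots> \<longleftrightarrow> openin (pre_realization ?X) {a \<in> topspace (pre_realization ?X). orbit_point a \<in> U}"
    proof -
      have "{t \<in> standard_simplex n. (n, orb Ps, t) \<in> {a \<in> topspace (pre_realization ?X). orbit_point a \<in> U}}
          = {t \<in> standard_simplex n. bary Ps t \<in> V}" if "Ps \<in> chains n" for n Ps
        using that bary_complex_point[OF that]
        by (auto simp: topspace_pre_realization p_orbit_sset_def simplices_quotient orbit_point V_def)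
      then show ?thesis
        by (subst openin_pre_realization) (auto simp: p_orbit_sset_def simplices_quotient)
    qed
    finally show ?thesis ..
  qed
  ultimately show ?thesis unfolding quotient_map_def top by simp
qed

lemma sset_realization_homeomorphic:
  "sset_realization (p_orbit_sset G p) homeomorphic_space p_complex_orbit_space G p"
proof (rule homeomorphic_space_quotient_maps[OF _ quotient_map_orbit_point])
  show "quotient_map (pre_realization (p_orbit_sset G p)) (sset_realization (p_orbit_sset G p))
      (\<lambda>a. realization_equiv `` {a})"
    unfolding sset_realization_def by (rule quotient_map_quotient_space)
  fix a b assume "a \<in> topspace (pre_realization (p_orbit_sset G p))"
    "b \<in> topspace (pre_realization (p_orbit_sset G p))"
  then have "orbit_point a = orbit_point b \<longleftrightarrow> (a, b) \<in> realization_equiv"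
    by (rule orbit_point_eq_iff)
  also have "\<dots> \<longleftrightarrow> realization_equiv `` {a} = realization_equiv `` {b}"
  proof
    assume "(a, b) \<in> realization_equiv"
    then show "realization_equiv `` {a} = realization_equiv `` {b}"
      using rtrancl_trans[of a b] rtrancl_trans[of b a] sym_realization_equiv[of a b] by blast
  next
    assume "realization_equiv `` {a} = realization_equiv `` {b}"
    then have "b \<in> realization_equiv `` {a}" by auto
    then show "(a, b) \<in> realization_equiv" by simp
  qed
  finally show "(realization_equiv `` {a} = realization_equiv `` {b}) = (orbit_point a = orbit_point b)" ..
qed

end

section \<open>Extending a chain by a Sylow subgroup of its normalizer\<close>

locale finite_p_chains = p_chains +
  assumes fin: "finite (carrier G)" and prime: "prime p"
begin

definition sylow_extension :: "'a set list \<Rightarrow> 'a set \<Rightarrow> bool" where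
  "sylow_extension Ps Q \<longleftrightarrow> sylow_subgroup (G\<lparr>carrier := chain_normalizer G Ps\<rparr>) p Q"

text \<open>
  The chains that cannot be enlarged by a Sylow subgroup of their normalizer; they give the cells
  without a partner above.
\<close>

definition saturated :: "'a set list \<Rightarrow> bool" where
  "saturated Ps \<longleftrightarrow> sylow_extension Ps (last Ps)"

lemma group_normalizer:
  assumes "\<forall>P\<in>set Ps. P \<subseteq> carrier G"
  shows "group (G\<lparr>carrier := chain_normalizer G Ps\<rparr>)"
    and "finite (carrier (G\<lparr>carrier := chain_normalizer G Ps\<rparr>))"
  using subgroup_imp_group[OF subgroup_chain_normalizer[OF assms]]
    finite_subset[OF subgroup.subset[OF subgroup_chain_normalizer[OF assms]] fin] by simp_all

lemma sylow_extensionD: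
  assumes "\<forall>P\<in>set Ps. P \<subseteq> carrier G" "sylow_extension Ps Q"
  shows "subgroup Q G" "Q \<subseteq> carrier G" "Q \<subseteq> chain_normalizer G Ps"
    "card Q = p ^ multiplicity p (card (chain_normalizer G Ps))"
proof -
  have Q: "subgroup Q (G\<lparr>carrier := chain_normalizer G Ps\<rparr>)"
    and *: "card Q = p ^ multiplicity p (card (chain_normalizer G Ps))"
    using assms(2) by (auto simp: sylow_extension_def sylow_subgroup_def order_def)
  show "subgroup Q G" by (rule incl_subgroup[OF subgroup_chain_normalizer[OF assms(1)] Q])
  then show "Q \<subseteq> carrier G" by (rule subgroup.subset)
  show "Q \<subseteq> chain_normalizer G Ps" using subgroup.subset[OF Q] by simp
  show "card Q = p ^ multiplicity p (card (chain_normalizer G Ps))" by (fact *)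
qed

lemma sylow_extensionI:
  assumes "\<forall>P\<in>set Ps. P \<subseteq> carrier G" "subgroup Q G" "Q \<subseteq> chain_normalizer G Ps"
    "card Q = p ^ multiplicity p (card (chain_normalizer G Ps))"
  shows "sylow_extension Ps Q"
  using subgroup_incl[OF assms(2) subgroup_chain_normalizer[OF assms(1)] assms(3)] assms(4)
  by (simp add: sylow_extension_def sylow_subgroup_def order_def)

lemma ex_sylow_extension:
  "\<forall>P\<in>set Ps. P \<subseteq> carrier G \<Longrightarrow> \<exists>Q. sylow_extension Ps Q"
  unfolding sylow_extension_def using group.ex_sylow_subgroup[OF group_normalizer prime] by blast

lemma last_le_normalizer:
  assumes "Ps \<in> chains n"
  shows "last Ps \<subseteq> chain_normalizer G Ps"
  using assms p_simplex_members(3)[OF assms, of "last Ps"] p_simplex_nonempty[OF assms]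
  by (auto simp: chain_normalizer_def conj_chain_def p_simplex_iff intro!: map_idI)

text \<open>
  Some conjugate of \<open>last Ps\<close> inside the normalizer of the chain lies in \<open>Q\<close>, but elements of that
  normalizer fix \<open>last Ps\<close>.
\<close>

lemma last_le_sylow_extension:
  assumes Ps: "Ps \<in> chains n" and Q: "sylow_extension Ps Q"
  shows "last Ps \<subseteq> Q"
proof -
  note sub = p_simplex_carrier[OF Ps]
  have L: "last Ps \<in> set Ps" using p_simplex_nonempty[OF Ps] by simp
  interpret N: group "G\<lparr>carrier := chain_normalizer G Ps\<rparr>" by (rule group_normalizer[OF sub])
  have "subgroup (last Ps) (G\<lparr>carrier := chain_normalizer G Ps\<rparr>)"
    using p_simplex_members(2)[OF Ps L] last_le_normalizer[OF Ps] subgroup_chain_normalizer[OF sub]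
    by (intro subgroup_incl)
  moreover obtain k where "card (last Ps) = p ^ k"
    using p_simplex_members(1)[OF Ps L] by (auto simp: nontrivial_p_subgroup_def)
  ultimately obtain h where h: "h \<in> chain_normalizer G Ps"
    "conj_subgroup (G\<lparr>carrier := chain_normalizer G Ps\<rparr>) h (last Ps) \<subseteq> Q"
    using N.p_subgroup_conj_le_sylow[OF group_normalizer(2)[OF sub] prime]
      Q[unfolded sylow_extension_def] by fastforce
  moreover have "conj_subgroup G h (last Ps) = last Ps"
  proof -
    have "map (conj_subgroup G h) Ps = Ps"
      using h(1) by (simp add: chain_normalizer_def conj_chain_def)
    then show ?thesis using p_simplex_nonempty[OF Ps] by (metis last_map)
  qed
  ultimately show ?thesis
    using conj_subgroup_subgroup[OF subgroup_chain_normalizer[OF sub] h(1)] by simp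
qed

lemma conj_in_subgroup:
  assumes Q: "subgroup Q G" and x: "x \<in> Q"
  shows "conj_subgroup G x Q = Q"
proof -
  have le: "conj_subgroup G y Q \<subseteq> Q" if "y \<in> Q" for y
    using that Q subgroup.subset[OF Q]
    by (auto simp: conj_subgroup_image subgroup.m_closed subgroup.m_inv_closed subset_iff)
  have "x \<in> carrier G" using x subgroup.subset[OF Q] by blast
  then have "Q = conj_subgroup G x (conj_subgroup G (inv x) Q)"
    using subgroup.subset[OF Q] by (simp add: conj_subgroup_inv)
  also have "\<dots> \<subseteq> conj_subgroup G x Q"
    using le x Q by (intro conj_subgroup_mono) (simp add: subgroup.m_inv_closed)
  finally show ?thesis using le[OF x] by blast
qed

lemma extension_chain:
  assumes Ps: "Ps \<in> chains n" and Q: "sylow_extension Ps Q"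
  shows "Ps @ [Q] \<in> chains (Suc n)"
proof -
  note sub = p_simplex_carrier[OF Ps]
  note le = last_le_sylow_extension[OF assms]
  note Q' = sylow_extensionD[OF sub Q]
  have L: "last Ps \<in> set Ps" using p_simplex_nonempty[OF Ps] by simp
  have "Q \<noteq> {\<one>}"
  proof
    assume "Q = {\<one>}"
    then have "last Ps = {\<one>}"
      using le subgroup.one_closed[OF p_simplex_members(2)[OF Ps L]] by blast
    then show False using p_simplex_members(1)[OF Ps L] by (simp add: nontrivial_p_subgroup_def)
  qed
  then have "nontrivial_p_subgroup G p Q"
    using Q' by (auto simp: nontrivial_p_subgroup_def)
  moreover have "conj_subgroup G x P = P" if "x \<in> Q" "P \<in> set Ps" for x P
  proof -
    have "map (conj_subgroup G x) Ps = Ps"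
      using Q'(3) that(1) by (auto simp: chain_normalizer_def conj_chain_def)
    then show ?thesis using that(2) by (metis in_set_conv_nth nth_map)
  qed
  moreover have "sorted_wrt (\<subseteq>) (Ps @ [Q])"
    using Ps p_simplex_members(4)[OF Ps] le by (auto simp: sorted_wrt_append p_simplex_iff)
  ultimately show ?thesis
    using Ps conj_in_subgroup[OF Q'(1)] by (auto simp: p_simplex_iff)
qed

text \<open>
  The normalizer of \<open>Ps @ [Q]\<close> is the normalizer of \<open>Q\<close> in the normalizer of \<open>Ps\<close>, so
  \<open>sylow_subgroup_of_normalizer\<close> applies inside the latter group. For \<open>Ps = []\<close> that group is
  all of \<open>G\<close>, which is how the Sylow subgroups of \<open>G\<close> appear as the only critical vertices.
\<close>

lemma saturated_snoc_iff:
  assumes sub: "\<forall>P\<in>set Ps. P \<subseteq> carrier G" and Q: "subgroup Q G" "Q \<subseteq> chain_normalizer G Ps"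
  shows "saturated (Ps @ [Q]) \<longleftrightarrow> sylow_extension Ps Q"
proof -
  define N where "N = chain_normalizer G Ps"
  define M where "M = chain_normalizer G (Ps @ [Q])"
  have sub': "\<forall>P\<in>set (Ps @ [Q]). P \<subseteq> carrier G" using sub subgroup.subset[OF Q(1)] by auto
  have N: "subgroup N G" and M: "subgroup M G"
    unfolding N_def M_def using subgroup_chain_normalizer sub sub' by blast+
  have MN: "M \<subseteq> N" unfolding M_def N_def by (auto simp: chain_normalizer_append)
  have QM: "Q \<subseteq> M"
    using Q conj_in_subgroup by (auto simp: M_def chain_normalizer_append)
  interpret N: group "G\<lparr>carrier := N\<rparr>" unfolding N_def by (rule group_normalizer[OF sub])
  have finN: "finite (carrier (G\<lparr>carrier := N\<rparr>))" unfolding N_def by (rule group_normalizer[OF sub])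
  have M_eq: "M = {h \<in> carrier (G\<lparr>carrier := N\<rparr>). conj_subgroup (G\<lparr>carrier := N\<rparr>) h Q = Q}"
    using conj_subgroup_subgroup[OF N] by (auto simp: M_def N_def chain_normalizer_append)
  have QN: "subgroup Q (G\<lparr>carrier := N\<rparr>)" using Q N by (simp add: subgroup_incl N_def)
  have "sylow_subgroup (G\<lparr>carrier := M\<rparr>) p Q \<longleftrightarrow> sylow_subgroup (G\<lparr>carrier := N\<rparr>) p Q"
  proof
    assume "sylow_subgroup (G\<lparr>carrier := M\<rparr>) p Q"
    then show "sylow_subgroup (G\<lparr>carrier := N\<rparr>) p Q"
      using N.sylow_subgroup_of_normalizer[OF finN prime QN] unfolding M_eq by simp
  next
    assume "sylow_subgroup (G\<lparr>carrier := N\<rparr>) p Q"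
    then show "sylow_subgroup (G\<lparr>carrier := M\<rparr>) p Q"
      using N.sylow_subgroup_of_subgroup[OF finN prime, of Q M] subgroup_incl[OF M N MN] QM by simp
  qed
  then show ?thesis by (simp add: saturated_def sylow_extension_def M_def N_def)
qed

lemma chain_normalizer_conj:
  assumes g: "g \<in> carrier G" and sub: "\<forall>P\<in>set Ps. P \<subseteq> carrier G"
  shows "chain_normalizer G (conj_chain G g Ps) = conj_subgroup G g (chain_normalizer G Ps)"
proof -
  have sub': "\<forall>P\<in>set (conj_chain G h Qs). P \<subseteq> carrier G"
    if "h \<in> carrier G" "\<forall>P\<in>set Qs. P \<subseteq> carrier G" for h Qs
    using that conj_subgroup_closed by (auto simp: conj_chain_def)
  have le: "conj_subgroup G h (chain_normalizer G Qs) \<subseteq> chain_normalizer G (conj_chain G h Qs)"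
    if h: "h \<in> carrier G" and Qs: "\<forall>P\<in>set Qs. P \<subseteq> carrier G" for h Qs
  proof
    fix x assume "x \<in> conj_subgroup G h (chain_normalizer G Qs)"
    then obtain y where y: "y \<in> carrier G" "conj_chain G y Qs = Qs" "x = h \<otimes> y \<otimes> inv h"
      using h by (auto simp: conj_subgroup_image chain_normalizer_def)
    have "conj_chain G x (conj_chain G h Qs) = conj_chain G (h \<otimes> y) (conj_chain G (inv h) (conj_chain G h Qs))"
      using h y(1) sub'[OF h Qs] unfolding y(3) by (simp add: conj_chain_mult)
    also have "\<dots> = conj_chain G h Qs"
      using h y(1,2) Qs by (simp add: conj_chain_inv conj_chain_mult)
    finally show "x \<in> chain_normalizer G (conj_chain G h Qs)"
      using y h by (simp add: chain_normalizer_def)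
  qed
  have c: "chain_normalizer G Qs \<subseteq> carrier G" for Qs by (auto simp: chain_normalizer_def)
  have "conj_subgroup G (inv g) (chain_normalizer G (conj_chain G g Ps)) \<subseteq> chain_normalizer G Ps"
    using le[of "inv g" "conj_chain G g Ps"] g sub sub'[OF g sub] by (simp add: conj_chain_inv)
  then have "conj_subgroup G g (conj_subgroup G (inv g) (chain_normalizer G (conj_chain G g Ps)))
      \<subseteq> conj_subgroup G g (chain_normalizer G Ps)" by (rule conj_subgroup_mono)
  then show ?thesis using le[OF g sub] g by (simp add: conj_subgroup_inv c)
qed

lemma sylow_extension_conj:
  assumes g: "g \<in> carrier G" and sub: "\<forall>P\<in>set Ps. P \<subseteq> carrier G" and Q: "sylow_extension Ps Q"
  shows "sylow_extension (conj_chain G g Ps) (conj_subgroup G g Q)"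
proof (rule sylow_extensionI)
  note Q' = sylow_extensionD[OF sub Q]
  have c: "chain_normalizer G Ps \<subseteq> carrier G" by (auto simp: chain_normalizer_def)
  show "\<forall>P\<in>set (conj_chain G g Ps). P \<subseteq> carrier G"
    using g sub conj_subgroup_closed by (auto simp: conj_chain_def)
  show "subgroup (conj_subgroup G g Q) G" using g Q' by (simp add: subgroup_conj_subgroup)
  show "conj_subgroup G g Q \<subseteq> chain_normalizer G (conj_chain G g Ps)"
    unfolding chain_normalizer_conj[OF g sub] using Q' by (intro conj_subgroup_mono)
  show "card (conj_subgroup G g Q) = p ^ multiplicity p (card (chain_normalizer G (conj_chain G g Ps)))"
    using Q' c g by (simp add: chain_normalizer_conj[OF g sub] card_conj_subgroup)
qed

lemma saturated_conj:
  assumes g: "g \<in> carrier G" and Ps: "Ps \<in> chains n"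
  shows "saturated (conj_chain G g Ps) \<longleftrightarrow> saturated Ps"
proof -
  have imp: "saturated (conj_chain G h Qs)" if "h \<in> carrier G" "Qs \<in> chains n" "saturated Qs" for h Qs
    using sylow_extension_conj[OF that(1) p_simplex_carrier[OF that(2)]] that(3)
      p_simplex_nonempty[OF that(2)]
    by (simp add: saturated_def conj_chain_def last_map)
  show ?thesis
    using imp[OF g Ps] imp[of "inv g" "conj_chain G g Ps"] act_closed[OF g Ps] g
      conj_chain_inv[OF g p_simplex_carrier[OF Ps]] by auto
qed

text \<open>
  All extensions of all members of the orbit at once: by Sylow's theorem they form a single orbit, so
  the matching needs no choices.
\<close>

definition extend :: "'a set list set \<Rightarrow> 'a set list set" where
  "extend A = {Ps @ [Q] | Ps Q. Ps \<in> A \<and> sylow_extension Ps Q}"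

text \<open>
  An extension of a conjugate \<open>gPs\<close> differs from \<open>g(Ps @ [Q])\<close> by a conjugation between two Sylow
  subgroups of the normalizer of \<open>gPs\<close>, which does not move \<open>gPs\<close>.
\<close>

lemma extend_orbit:
  assumes Ps: "Ps \<in> chains n" and Q: "sylow_extension Ps Q"
  shows "extend (orb Ps) = orb (Ps @ [Q])"
proof (intro equalityI subsetI)
  fix Rs assume "Rs \<in> orb (Ps @ [Q])"
  then show "Rs \<in> extend (orb Ps)"
    using sylow_extension_conj[OF _ p_simplex_carrier[OF Ps] Q]
    by (auto simp: orbit_def extend_def conj_chain_def)
next
  fix Rs assume "Rs \<in> extend (orb Ps)"
  then obtain g R where g: "g \<in> carrier G" and Rs: "Rs = conj_chain G g Ps @ [R]"
    and R: "sylow_extension (conj_chain G g Ps) R"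
    by (auto simp: orbit_def extend_def)
  note sub = p_simplex_carrier[OF act_closed[OF g Ps]]
  interpret N: group "G\<lparr>carrier := chain_normalizer G (conj_chain G g Ps)\<rparr>"
    by (rule group_normalizer[OF sub])
  obtain h where h: "h \<in> chain_normalizer G (conj_chain G g Ps)"
    "R = conj_subgroup G h (conj_subgroup G g Q)"
    using N.sylow_subgroups_conj[OF group_normalizer(2)[OF sub] prime]
      sylow_extension_conj[OF g p_simplex_carrier[OF Ps] Q] R
      conj_subgroup_subgroup[OF subgroup_chain_normalizer[OF sub]]
    by (fastforce simp: sylow_extension_def)
  have "Rs = conj_chain G h (conj_chain G g (Ps @ [Q]))"
    using h unfolding Rs by (simp add: chain_normalizer_def conj_chain_def)
  also have "\<dots> = conj_chain G (h \<otimes> g) (Ps @ [Q])"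
    using h g p_simplex_carrier[OF extension_chain[OF Ps Q]]
    by (simp add: conj_chain_mult chain_normalizer_def)
  finally show "Rs \<in> orb (Ps @ [Q])"
    using h g by (auto simp: orbit_def chain_normalizer_def)
qed

end

section \<open>The Morse matching\<close>

context finite_p_chains
begin

definition critical_cells :: "(nat \<times> 'a set list set) set" where
  "critical_cells = {(0, orb Ps) | Ps. Ps \<in> chains 0 \<and> saturated Ps}"

definition collapsible_cells :: "(nat \<times> 'a set list set) set" where
  "collapsible_cells =
     {(Suc n, orb Ps) | n Ps. Ps \<in> chains (Suc n) \<and> strict Ps \<and> saturated Ps}"

definition redundant_cells :: "(nat \<times> 'a set list set) set" where
  "redundant_cells =
     {(n, orb Ps) | n Ps. Ps \<in> chains n \<and> strict Ps \<and> \<not> saturated Ps}"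

definition collapse :: "nat \<times> 'a set list set \<Rightarrow> nat \<times> 'a set list set" where
  "collapse = (\<lambda>(n, A). (Suc n, extend A))"

lemma strict_conj:
  assumes g: "g \<in> carrier G" and Ps: "Ps \<in> chains n"
  shows "strict (conj_chain G g Ps) \<longleftrightarrow> strict Ps"
proof -
  have "conj_subgroup G g (Ps ! i) \<subset> conj_subgroup G g (Ps ! j) \<longleftrightarrow> Ps ! i \<subset> Ps ! j"
    if "i < length Ps" "j < length Ps" for i j
    using that p_simplex_carrier[OF Ps] g
    by (simp add: psubset_eq conj_subgroup_subset_iff conj_subgroup_eq_iff)
  then show ?thesis by (auto simp: sorted_wrt_iff_nth_less conj_chain_nth)
qed

lemma cell_iff:
  assumes "Ps \<in> chains n"
  shows "(m, orb Ps) \<in> redundant_cells \<longleftrightarrow> m = n \<and> strict Ps \<and> \<not> saturated Ps"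
    and "(m, orb Ps) \<in> collapsible_cells \<longleftrightarrow> m = n \<and> n \<noteq> 0 \<and> strict Ps \<and> saturated Ps"
    and "(m, orb Ps) \<in> critical_cells \<longleftrightarrow> m = n \<and> n = 0 \<and> saturated Ps"
proof -
  have *: "m = n \<and> (strict Qs \<longleftrightarrow> strict Ps) \<and> (saturated Qs \<longleftrightarrow> saturated Ps)"
    if "orb Ps = orb Qs" "Qs \<in> chains m" for m Qs
  proof -
    have "Qs \<in> orb Ps" using orb_refl[OF that(2)] that(1) by simp
    then obtain g where g: "g \<in> carrier G" "Qs = conj_chain G g Ps" by (auto simp: orbit_def)
    then have "m = n" using p_simplex_length[OF that(2)] p_simplex_length[OF assms] by simp
    then show ?thesis using g strict_conj[OF g(1) assms] saturated_conj[OF g(1) assms] by simp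
  qed
  show "(m, orb Ps) \<in> redundant_cells \<longleftrightarrow> m = n \<and> strict Ps \<and> \<not> saturated Ps"
    unfolding redundant_cells_def using * assms by blast
  show "(m, orb Ps) \<in> collapsible_cells \<longleftrightarrow> m = n \<and> n \<noteq> 0 \<and> strict Ps \<and> saturated Ps"
  proof
    assume "(m, orb Ps) \<in> collapsible_cells"
    then show "m = n \<and> n \<noteq> 0 \<and> strict Ps \<and> saturated Ps"
      unfolding collapsible_cells_def using * by blast
  next
    assume "m = n \<and> n \<noteq> 0 \<and> strict Ps \<and> saturated Ps"
    then show "(m, orb Ps) \<in> collapsible_cells"
      unfolding collapsible_cells_def using assms by (cases n) auto
  qed
  show "(m, orb Ps) \<in> critical_cells \<longleftrightarrow> m = n \<and> n = 0 \<and> saturated Ps"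
    unfolding critical_cells_def using * assms by blast
qed

lemma redundant_cellE:
  assumes "\<tau> \<in> redundant_cells"
  obtains n Ps Q where "\<tau> = (n, orb Ps)" "Ps \<in> chains n" "strict Ps" "\<not> saturated Ps"
    "sylow_extension Ps Q" "collapse \<tau> = (Suc n, orb (Ps @ [Q]))"
    "Ps @ [Q] \<in> chains (Suc n)" "last Ps \<subset> Q"
proof -
  obtain n Ps where *: "\<tau> = (n, orb Ps)" "Ps \<in> chains n" "strict Ps" "\<not> saturated Ps"
    using assms unfolding redundant_cells_def by blast
  obtain Q where Q: "sylow_extension Ps Q"
    using ex_sylow_extension[OF p_simplex_carrier[OF *(2)]] by blast
  have "last Ps \<noteq> Q" using *(4) Q by (auto simp: saturated_def)
  then have "last Ps \<subset> Q" using last_le_sylow_extension[OF *(2) Q] by blast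
  then show ?thesis
    using that[OF * Q _ extension_chain[OF *(2) Q]] extend_orbit[OF *(2) Q] *(1)
    by (simp add: collapse_def)
qed

lemma strict_snoc:
  assumes "Ps \<in> chains n" "strict Ps" "last Ps \<subset> Q"
  shows "strict (Ps @ [Q])"
  using assms p_simplex_members(4)[OF assms(1)] by (auto simp: sorted_wrt_append)

lemma saturated_extension:
  assumes "Ps \<in> chains n" "sylow_extension Ps Q"
  shows "saturated (Ps @ [Q])"
  using saturated_snoc_iff[of Ps Q] sylow_extensionD[of Ps Q] p_simplex_carrier assms by blast

lemma face_last_orbit:
  assumes "Ps @ [Q] \<in> chains (Suc n)"
  shows "face (p_orbit_sset G p) (Suc n) (Suc n) (orb (Ps @ [Q])) = orb Ps"
  using face_quotient[OF assms, of "Suc n"] p_simplex_length[OF assms]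
  by (simp add: p_orbit_sset_def p_face omit_def)

text \<open>
  The last face recovers a cell from its partner, whence injectivity. The map is onto because the top
  of a saturated chain of positive dimension is a Sylow subgroup of the normalizer of the rest.
\<close>

lemma collapse_bij: "bij_betw collapse redundant_cells collapsible_cells"
proof (rule bij_betwI')
  fix \<tau> \<tau>' assume t: "\<tau> \<in> redundant_cells" and t': "\<tau>' \<in> redundant_cells"
  obtain n Ps Q where *: "\<tau> = (n, orb Ps)" "collapse \<tau> = (Suc n, orb (Ps @ [Q]))"
    "Ps @ [Q] \<in> chains (Suc n)" using redundant_cellE[OF t] by metis
  obtain n' Ps' Q' where ob: "\<tau>' = (n', orb Ps')" "collapse \<tau>' = (Suc n', orb (Ps' @ [Q']))"
    "Ps' @ [Q'] \<in> chains (Suc n')" using redundant_cellE[OF t'] by metis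
  show "(collapse \<tau> = collapse \<tau>') = (\<tau> = \<tau>')"
  proof
    assume eq: "collapse \<tau> = collapse \<tau>'"
    then show "\<tau> = \<tau>'"
      using * ob face_last_orbit[OF *(3)] face_last_orbit[OF ob(3)] by simp
  qed simp
next
  fix \<tau> assume "\<tau> \<in> redundant_cells"
  then obtain n Ps Q where *: "\<tau> = (n, orb Ps)" "Ps \<in> chains n" "strict Ps"
    "sylow_extension Ps Q" "collapse \<tau> = (Suc n, orb (Ps @ [Q]))"
    "Ps @ [Q] \<in> chains (Suc n)" "last Ps \<subset> Q" by (elim redundant_cellE)
  show "collapse \<tau> \<in> collapsible_cells"
    unfolding *(5) using cell_iff(2)[OF *(6)] strict_snoc[OF *(2,3,7)] saturated_extension[OF *(2,4)]
    by blast
next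
  fix \<sigma> assume "\<sigma> \<in> collapsible_cells"
  then obtain n Rs where Rs: "\<sigma> = (Suc n, orb Rs)" "Rs \<in> chains (Suc n)" "strict Rs" "saturated Rs"
    unfolding collapsible_cells_def by blast
  obtain Ps Q where Rs_eq: "Rs = Ps @ [Q]"
    using p_simplex_nonempty[OF Rs(2)] by (cases Rs rule: rev_cases) auto
  have Ps: "Ps \<in> chains n"
    using p_face_closed[OF Rs(2), of "Suc n"] p_simplex_length[OF Rs(2)]
    by (simp add: Rs_eq p_face omit_def)
  note sub = p_simplex_carrier[OF Ps]
  have Q: "subgroup Q G" using p_simplex_members(2)[OF Rs(2)] by (simp add: Rs_eq)
  have "Q \<subseteq> chain_normalizer G Ps"
    using last_le_normalizer[OF Rs(2)] by (auto simp: Rs_eq chain_normalizer_append)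
  then have ext: "sylow_extension Ps Q"
    using saturated_snoc_iff[OF sub Q] Rs(4) by (simp add: Rs_eq)
  have lt: "last Ps \<subset> Q"
    using Rs(3) p_simplex_nonempty[OF Ps] by (auto simp: Rs_eq sorted_wrt_append)
  have "card (last Ps) < card Q"
    using psubset_card_mono[OF finite_subset[OF subgroup.subset[OF Q] fin] lt] .
  then have "\<not> saturated Ps"
    using sylow_extensionD(4)[OF sub ext] sylow_extensionD(4)[OF sub, of "last Ps"]
    unfolding saturated_def by linarith
  moreover have "strict Ps" using Rs(3) by (simp add: Rs_eq sorted_wrt_append)
  ultimately have "(n, orb Ps) \<in> redundant_cells" using cell_iff(1)[OF Ps] by blast
  moreover have "\<sigma> = collapse (n, orb Ps)"
    using extend_orbit[OF Ps ext] by (simp add: Rs collapse_def Rs_eq)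
  ultimately show "\<exists>\<tau>\<in>redundant_cells. \<sigma> = collapse \<tau>" by blast
qed

text \<open>
  The choice of the member is immaterial, since conjugate chains have tops of the same order.
\<close>

definition top_card :: "'a set list set \<Rightarrow> nat" where
  "top_card A = card (last (SOME Ps. Ps \<in> A))"

lemma top_card_orbit:
  assumes "Ps \<in> chains n"
  shows "top_card (orb Ps) = card (last Ps)"
proof -
  have "(SOME Qs. Qs \<in> orb Ps) \<in> orb Ps" using orb_refl[OF assms] by (rule someI)
  then obtain g where g: "g \<in> carrier G" "(SOME Qs. Qs \<in> orb Ps) = conj_chain G g Ps"
    by (auto simp: orbit_def)
  show ?thesis
    unfolding top_card_def g(2)
    using p_simplex_nonempty[OF assms] p_simplex_carrier[OF assms] g(1)
    by (simp add: conj_chain_def last_map card_conj_subgroup)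
qed

lemma last_omit: "i < length xs - 1 \<Longrightarrow> last (omit i xs) = last xs"
  by (simp add: omit_def)

text \<open>
  The first entry of the measure is the dimension of the lower cell of the pair that the vertex
  belongs to, plus one. A step up keeps it and enlarges the top. A step down keeps the top, since
  only the matched face omits it; the step either ends in a redundant cell of the same level, which
  the last entry counts as progress, or in a collapsible cell of a lower level.
\<close>

lemma matching_edge_decreases:
  assumes "(v, w) \<in> matching_edges (p_orbit_sset G p) collapsible_cells redundant_cells
    collapse (\<lambda>v. Suc (fst v))"
  shows "(w, v) \<in> measures
    [\<lambda>v. if v \<in> collapsible_cells then fst v else Suc (fst v),
     \<lambda>v. order G - top_card (snd v),
     \<lambda>v. if v \<in> collapsible_cells then 1 else 0]"
proof -
  consider (up) \<tau> where "(v, w) = (\<tau>, collapse \<tau>)" "\<tau> \<in> redundant_cells"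
    | (down) n x j where "(v, w) = ((Suc n, x), (n, face (p_orbit_sset G p) (Suc n) j x))"
      "(Suc n, x) \<in> collapsible_cells" "j \<le> Suc n"
      "j \<noteq> Suc (fst (inv_into redundant_cells collapse (Suc n, x)))"
    using assms unfolding matching_edges_def by blast
  then show ?thesis
  proof cases
    case up
    note e = up(1)
    from up(2) obtain n Ps Q where *: "\<tau> = (n, orb Ps)" "Ps \<in> chains n" "strict Ps" "\<not> saturated Ps"
      "sylow_extension Ps Q" "collapse \<tau> = (Suc n, orb (Ps @ [Q]))"
      "Ps @ [Q] \<in> chains (Suc n)" "last Ps \<subset> Q" by (elim redundant_cellE)
    have "v \<notin> collapsible_cells" using e *(1,4) cell_iff(2)[OF *(2)] by auto
    moreover have "w \<in> collapsible_cells"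
      using e bij_betwE[OF collapse_bij] up(2) by auto
    moreover have "top_card (snd v) < top_card (snd w)" "top_card (snd w) \<le> order G"
    proof -
      have Q: "Q \<subseteq> carrier G" using p_simplex_carrier[OF *(7)] by simp
      then show "top_card (snd w) \<le> order G"
        using e *(6) top_card_orbit[OF *(7)] card_mono[OF fin] by (simp add: order_def)
      show "top_card (snd v) < top_card (snd w)"
        using e *(1,6,8) top_card_orbit[OF *(2)] top_card_orbit[OF *(7)]
          psubset_card_mono[OF finite_subset[OF Q fin]] by simp
    qed
    ultimately show ?thesis using e *(1,6) by simp
  next
    case down
    note e = down(1) and x = down(2) and j = down(3,4)
    obtain Rs where Rs: "x = orb Rs" "Rs \<in> chains (Suc n)"
      using x unfolding collapsible_cells_def by blast
    define \<tau> where "\<tau> = inv_into redundant_cells collapse (Suc n, x)"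
    have "collapse \<tau> = (Suc n, x)"
      unfolding \<tau>_def using x collapse_bij by (auto simp: bij_betw_def f_inv_into_f)
    then have "fst \<tau> = n" by (auto simp: collapse_def split: prod.splits)
    then have jn: "j < Suc n" using j by (simp add: \<tau>_def)
    have w: "w = (n, orb (omit j Rs))"
      using e face_quotient[OF Rs(2) j(1)] by (simp add: p_orbit_sset_def Rs p_face)
    have "omit j Rs \<in> chains n" using p_face_closed[OF Rs(2) j(1)] by (simp add: p_face)
    then have "top_card (snd w) = top_card (snd v)"
      using e w top_card_orbit[OF Rs(2)] top_card_orbit[of "omit j Rs" n] jn
        p_simplex_length[OF Rs(2)] by (simp add: Rs(1) last_omit)
    then show ?thesis using e x w by simp
  qed
qed

lemma morse_matching_p_orbit_sset:
  "morse_matching (p_orbit_sset G p) critical_cells collapsible_cells redundant_cells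
    collapse (\<lambda>v. Suc (fst v))"
proof (intro morse_matching.intro morse_matching_axioms.intro)
  show "simplicial_set (p_orbit_sset G p)"
    unfolding p_orbit_sset_def by (rule simplicial_set_quotient)
  have vertex: "strict Ps" if "Ps \<in> chains 0" for Ps
    using p_simplex_length[OF that] by (cases Ps) auto
  show "cells (p_orbit_sset G p) = critical_cells \<union> collapsible_cells \<union> redundant_cells"
  proof (intro equalityI subsetI)
    fix v assume "v \<in> cells (p_orbit_sset G p)"
    then obtain n Ps where *: "v = (n, orb Ps)" "Ps \<in> chains n" "strict Ps"
      unfolding p_orbit_sset_def cells_quotient nondegenerate_p_sset by blast
    then show "v \<in> critical_cells \<union> collapsible_cells \<union> redundant_cells"
      using cell_iff[OF *(2)] by blast
  next
    fix v assume "v \<in> critical_cells \<union> collapsible_cells \<union> redundant_cells"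
    then show "v \<in> cells (p_orbit_sset G p)"
      unfolding p_orbit_sset_def cells_quotient nondegenerate_p_sset
        critical_cells_def collapsible_cells_def redundant_cells_def using vertex by blast
  qed
  have orbit_form: "\<exists>n Ps. v = (n, orb Ps) \<and> Ps \<in> chains n"
    if "v \<in> critical_cells \<union> collapsible_cells" for v
    using that unfolding critical_cells_def collapsible_cells_def by blast
  show "critical_cells \<inter> collapsible_cells = {}" "critical_cells \<inter> redundant_cells = {}"
    "collapsible_cells \<inter> redundant_cells = {}"
    using orbit_form cell_iff by blast+
  show "bij_betw collapse redundant_cells collapsible_cells" by (rule collapse_bij)
  show "fst (collapse (n, x)) = Suc n" for n x by (simp add: collapse_def)
  show "Suc (fst (n, x)) \<le> Suc n" for n :: nat and x :: "'a set list set" by simp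
  show "x = face (p_orbit_sset G p) (Suc n) (Suc (fst (n, x))) (snd (collapse (n, x)))"
    if red: "(n, x) \<in> redundant_cells" for n x
  proof -
    obtain m Ps Q where *: "(n, x) = (m, orb Ps)" "collapse (n, x) = (Suc m, orb (Ps @ [Q]))"
      "Ps @ [Q] \<in> chains (Suc m)" using redundant_cellE[OF red] by metis
    then show ?thesis using face_last_orbit[OF *(3)] by simp
  qed
  show "\<not> (\<exists>v. \<forall>k. (v k, v (Suc k)) \<in> matching_edges (p_orbit_sset G p) collapsible_cells
      redundant_cells collapse (\<lambda>v. Suc (fst v)))"
  proof
    assume "\<exists>v. \<forall>k. (v k, v (Suc k)) \<in> matching_edges (p_orbit_sset G p) collapsible_cells
      redundant_cells collapse (\<lambda>v. Suc (fst v))"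
    then obtain v where "\<And>k. (v (Suc k), v k) \<in> measures
      [\<lambda>v. if v \<in> collapsible_cells then fst v else Suc (fst v),
       \<lambda>v. order G - top_card (snd v),
       \<lambda>v. if v \<in> collapsible_cells then 1 else 0]"
      using matching_edge_decreases by blast
    then show False using wf_measures wf_iff_no_infinite_down_chain by blast
  qed
qed

lemma critical_cells_sylow:
  assumes dvd: "p dvd order G" and P: "sylow_subgroup G p P"
  shows "critical_cells = {(0, orb [P])}"
proof -
  have sat: "saturated [Q] \<longleftrightarrow> sylow_subgroup G p Q" if "subgroup Q G" for Q
    using saturated_snoc_iff[of "[]" Q] that subgroup.subset
    by (auto simp: sylow_extension_def chain_normalizer_Nil)
  have chain: "[Q] \<in> chains 0" if "sylow_subgroup G p Q" for Q
  proof -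
    have Q: "subgroup Q G" "card Q = p ^ multiplicity p (order G)"
      using that by (auto simp: sylow_subgroup_def)
    have "order G \<noteq> 0" using fin by (simp add: order_def card_eq_0_iff) (use one_closed in blast)
    then have "multiplicity p (order G) \<noteq> 0"
      using dvd prime_gt_1_nat[OF prime] by (auto simp: multiplicity_eq_zero_iff)
    then have "card Q \<noteq> 1" using Q(2) prime_gt_1_nat[OF prime] by simp
    then have "Q \<noteq> {\<one>}" by auto
    then have "nontrivial_p_subgroup G p Q" using Q by (auto simp: nontrivial_p_subgroup_def)
    then show ?thesis using conj_in_subgroup[OF Q(1)] by (simp add: p_simplex_iff)
  qed
  have "orb Ps = orb [P]" if Ps: "Ps \<in> chains 0" "saturated Ps" for Ps
  proof -
    obtain Q where Q: "Ps = [Q]" using p_simplex_length[OF Ps(1)] by (auto simp: length_Suc_conv)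
    then have "sylow_subgroup G p Q" using sat[of Q] p_simplex_members(2)[OF Ps(1)] Ps(2) by simp
    then obtain h where "h \<in> carrier G" "P = conj_subgroup G h Q"
      using sylow_subgroups_conj[OF fin prime _ P] by blast
    then show ?thesis
      using orb_eq_iff[OF Ps(1) chain[OF P]] by (auto simp: Q conj_chain_def)
  qed
  moreover have "saturated [P]" using P sat by (simp add: sylow_subgroup_def)
  ultimately show ?thesis
    unfolding critical_cells_def using chain[OF P] by blast
qed

end

theorem mainTheorem2:
  fixes G :: "('a, 'm) monoid_scheme" and p :: nat
  assumes "group G" and "finite (carrier G)" and "prime p" and "p dvd order G"
  shows "sset_realization (p_orbit_sset G p) homeomorphic_space p_complex_orbit_space G p \<and>
    (\<exists>critical collapsible redundant c \<iota>.
       morse_matching (p_orbit_sset G p) critical collapsible redundant c \<iota> \<and>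
       (\<exists>P. sylow_subgroup G p P) \<and>
       (\<forall>P. sylow_subgroup G p P \<longrightarrow> critical = {(0, orbit G (conj_chain G) [P])}))"
proof -
  interpret finite_p_chains G p
    using assms(1-3) by (simp add: finite_p_chains_def finite_p_chains_axioms_def p_chains_def)
  have "\<exists>P. sylow_subgroup G p P" by (rule ex_sylow_subgroup[OF fin prime])
  then show ?thesis
    using sset_realization_homeomorphic morse_matching_p_orbit_sset
      critical_cells_sylow[OF assms(4)] by blast
qed

end
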